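(* Fix a uniformity $r \ge 2$ and a residue class $k \not\equiv 0 \pmod r$. If $r$ is even and $S_i \times S_{r-i}$ is available for $\mathcal{C}_{\equiv k}^r\text{-}\mathrm{hom}$ for every odd $i \in [1,r-1]$, then $\gamma(\mathcal{C}_{\equiv k}^r\text{-}\mathrm{hom}) = 1/2$. Otherwise, $\gamma(\mathcal{C}_{\equiv k}^r\text{-}\mathrm{hom}) \le 1/3$.
   Context: An $r$-graph is an $r$-uniform hypergraph; $\delta_{r-1}(\mathcal{H})$ is the minimum number of edges containing an $(r-1)$-set of vertices. For a family $\mathcal{F}$, $\mathrm{ex}_{r-1}(n,\mathcal{F})$ is the maximum of $\delta_{r-1}(\mathcal{H})$ over $n$-vertex $r$-graphs containing no member of $\mathcal{F}$, and $\gamma(\mathcal{F}) = \lim_{n\to\infty}\mathrm{ex}_{r-1}(n,\mathcal{F})/n$. $\mathcal{C}_\ell^r$ ($\ell>r$) is the tight cycle on $\{0,\ldots,\ell-1\}$ with edges $\{i,\ldots,i+r-1\}$ modulo $\ell$; $\mathcal{C}_{\equiv k}^r$ is the family of tight cycles with $\ell\equiv k \pmod r$; $\mathcal{F}\text{-}\mathrm{hom}$ is the family of homomorphic images of members of $\mathcal{F}$ (images under edge-preserving vertex maps that are surjective on edges). Let $\mathrm{cyc}=(1\,2\,\cdots\,r)\in S_r$. A subgroup of $S_r$ is $\mathrm{cyc}^k$-conjugate avoiding if it contains no conjugate of $\mathrm{cyc}^k$. For $1\le i\le r-1$, $S_i\times S_{r-i}$ denotes the subgroup of $S_r$ of permutations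 preserving $\{1,\ldots,i\}$ and $\{i+1,\ldots,r\}$; it is available for $\mathcal{C}_{\equiv k}^r\text{-}\mathrm{hom}$ if it (or a conjugate of it) is a maximal $\mathrm{cyc}^k$-conjugate avoiding subgroup of $S_r$. *)

theory Defs
  imports Complex_Main "HOL-Number_Theory.Cong" "HOL-Algebra.Sym_Groups"
begin

record 'a hypergraph =
  verts :: "'a set"
  edges :: "'a set set"

definition r_graph :: "nat \<Rightarrow> 'a hypergraph \<Rightarrow> bool" where
  "r_graph r H \<longleftrightarrow> finite (verts H) \<and> (\<forall>e\<in>edges H. e \<subseteq> verts H \<and> card e = r)"

definition hypergraph_hom :: "('a \<Rightarrow> 'b) \<Rightarrow> 'a hypergraph \<Rightarrow> 'b hypergraph \<Rightarrow> bool" where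
  "hypergraph_hom \<phi> F G \<longleftrightarrow> \<phi> ` verts F \<subseteq> verts G \<and> (\<forall>e\<in>edges F. \<phi> ` e \<in> edges G)"

text \<open>Containment as a (not necessarily induced) subhypergraph, up to isomorphism.\<close>

definition contains_copy :: "'b hypergraph \<Rightarrow> 'a hypergraph \<Rightarrow> bool" where
  "contains_copy H F \<longleftrightarrow> (\<exists>\<phi>. inj_on \<phi> (verts F) \<and> hypergraph_hom \<phi> F H)"

definition family_free :: "'a hypergraph set \<Rightarrow> 'b hypergraph \<Rightarrow> bool" where
  "family_free \<F> H \<longleftrightarrow> (\<forall>F\<in>\<F>. \<not> contains_copy H F)"

text \<open>Below, \<open>Min\<close> is taken over a nonempty set as soon as \<open>H\<close> has at least \<open>r - 1\<close> vertices; for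
  fewer vertices the value is an unspecified constant, which does not affect limits.\<close>

definition min_codegree :: "nat \<Rightarrow> 'a hypergraph \<Rightarrow> nat" where
  "min_codegree r H =
     Min {card {e \<in> edges H. S \<subseteq> e} | S. S \<subseteq> verts H \<and> card S = r - 1}"

text \<open>Every finite hypergraph is isomorphic to one with vertices in \<open>nat\<close>, so it suffices to
  consider host graphs and families on that type.\<close>

definition codegree_ex :: "nat \<Rightarrow> nat \<Rightarrow> nat hypergraph set \<Rightarrow> nat" where
  "codegree_ex r n \<F> =
     Max {min_codegree r H | H :: nat hypergraph.
            r_graph r H \<and> card (verts H) = n \<and> family_free \<F> H}"

definition codegree_ratio :: "nat \<Rightarrow> nat hypergraph set \<Rightarrow> nat \<Rightarrow> real" where
  "codegree_ratio r \<F> n = real (codegree_ex r n \<F>) / real n"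

definition codegree_density :: "nat \<Rightarrow> nat hypergraph set \<Rightarrow> real" where
  "codegree_density r \<F> = lim (codegree_ratio r \<F>)"

definition tight_cycle :: "nat \<Rightarrow> nat \<Rightarrow> nat hypergraph" where
  "tight_cycle r l =
     \<lparr> verts = {0..<l}, edges = {(\<lambda>j. (i + j) mod l) ` {0..<r} | i. i < l} \<rparr>"

definition tight_cycle_family :: "nat \<Rightarrow> nat \<Rightarrow> nat hypergraph set" where
  "tight_cycle_family r k = {tight_cycle r l | l. l > r \<and> [l = k] (mod r)}"

text \<open>The images are required to be \<open>r\<close>-graphs, so the vertex maps are injective on every edge.\<close>

definition hom_family :: "nat \<Rightarrow> nat hypergraph set \<Rightarrow> nat hypergraph set" where
  "hom_family r \<F> =
     {G. r_graph r G \<and>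
         (\<exists>F\<in>\<F>. \<exists>\<phi>. hypergraph_hom \<phi> F G \<and> verts G = \<phi> ` verts F \<and>
                     edges G = (\<lambda>e. \<phi> ` e) ` edges F)}"

definition cyc :: "nat \<Rightarrow> nat \<Rightarrow> nat" where
  "cyc r = cycle_of_list [1..<Suc r]"

definition conjugate_avoiding :: "nat \<Rightarrow> (nat \<Rightarrow> nat) \<Rightarrow> (nat \<Rightarrow> nat) set \<Rightarrow> bool" where
  "conjugate_avoiding r x H \<longleftrightarrow>
     subgroup H (sym_group r) \<and>
     (\<forall>g\<in>carrier (sym_group r).
        g \<otimes>\<^bsub>sym_group r\<^esub> x \<otimes>\<^bsub>sym_group r\<^esub> inv\<^bsub>sym_group r\<^esub> g \<notin> H)"

definition maximal_conjugate_avoiding :: "nat \<Rightarrow> (nat \<Rightarrow> nat) \<Rightarrow> (nat \<Rightarrow> nat) set \<Rightarrow> bool" where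
  "maximal_conjugate_avoiding r x H \<longleftrightarrow>
     conjugate_avoiding r x H \<and> (\<forall>K. conjugate_avoiding r x K \<and> H \<subseteq> K \<longrightarrow> K = H)"

definition young_subgroup :: "nat \<Rightarrow> nat \<Rightarrow> (nat \<Rightarrow> nat) set" where
  "young_subgroup r i =
     {p \<in> carrier (sym_group r). p ` {1..i} = {1..i} \<and> p ` {Suc i..r} = {Suc i..r}}"

definition available :: "nat \<Rightarrow> nat \<Rightarrow> nat \<Rightarrow> bool" where
  "available r k i \<longleftrightarrow>
     (\<exists>g\<in>carrier (sym_group r).
        maximal_conjugate_avoiding r (cyc r [^]\<^bsub>sym_group r\<^esub> k)
          (g <#\<^bsub>sym_group r\<^esub> young_subgroup r i #>\<^bsub>sym_group r\<^esub> inv\<^bsub>sym_group r\<^esub> g))"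

end

theory Submission
  imports Defs "HOL-Combinatorics.Orbits" "HOL-Probability.Hoeffding" "HOL-Real_Asymp.Real_Asymp"
begin

text \<open>
  Let \<open>d = r div gcd r k\<close>; the permutation \<open>cyc\<^sup>k\<close> consists of \<open>d\<close>-cycles, so \<open>S\<^sub>i \<times> S\<^sub>r\<^sub>-\<^sub>i\<close> contains
  a conjugate of it iff \<open>d dvd i\<close>, and all odd \<open>i\<close> are available iff \<open>d\<close> is even.

  Replacing one vertex of an ordered edge by another one costs \<open>r\<close> steps of a tight walk. Hence in a
  free host no ordered edge can be turned into its rotation by \<open>k\<close> by such replacements. If all
  codegrees exceed \<open>n/3\<close> and the link graph of \<open>e - {a, b}\<close> is not bipartite, then \<open>a\<close> and \<open>b\<close> can
  be interchanged in the ordered edge \<open>e\<close>.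

  If all codegrees exceed \<open>n/2\<close>, every link graph contains a triangle and all permutations of an
  edge are reachable. For even \<open>d\<close> the edges that meet half of the vertices in an odd number of
  points show that this is optimal.

  If all codegrees exceed \<open>n/3\<close>, then among three vertices of an edge \<open>e\<close> two can be interchanged,
  since two of the three neighbourhoods of \<open>e - {a}\<close> intersect. So every edge splits into two blocks
  inside which all permutations are reachable, and in a free host no block size is a multiple of \<open>d\<close>.
  Passing to another component of the link graph of \<open>e - {x, x'}\<close>, with \<open>x\<close> and \<open>x'\<close> in one block,
  shrinks that block by exactly two. For odd \<open>d\<close> this leads to a block of size \<open>0\<close> or \<open>d\<close>, a
  contradiction.

  The limit exists because a random small sample of vertices of a large host almost preserves all
  relative codegrees.
\<close>

hide_const (open) Finite_Cartesian_Product.transpose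

subsection \<open>Pigeonhole, periodic sequences and permutation monoids\<close>

lemma not_disjoint_family_on_if_large:
  assumes "finite V" "finite I" "I \<noteq> {}"
    and sub: "\<And>i. i \<in> I \<Longrightarrow> N i \<subseteq> V"
    and "\<And>i. i \<in> I \<Longrightarrow> card V < card I * card (N i)"
  shows "\<not> disjoint_family_on N I"
proof
  assume disj: "disjoint_family_on N I"
  have "card I * card V = (\<Sum>i\<in>I. card V)" by simp
  also have "\<dots> < (\<Sum>i\<in>I. card I * card (N i))"
    using assms by (intro sum_strict_mono)
  also have "\<dots> = card I * card (\<Union>i\<in>I. N i)"
    using assms disj finite_subset[OF sub]
    by (simp add: card_UN_disjoint' sum_distrib_left)
  also have "\<dots> \<le> card I * card V"
    using assms by (intro mult_left_mono card_mono UN_least) auto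
  finally show False by simp
qed

lemma three_large_sets_meet:
  assumes V: "finite V" "A \<subseteq> V" "B \<subseteq> V" "C \<subseteq> V"
    and large: "card V < 3 * card A" "card V < 3 * card B" "card V < 3 * card C"
  shows "A \<inter> B \<noteq> {} \<or> A \<inter> C \<noteq> {} \<or> B \<inter> C \<noteq> {}"
proof (rule ccontr)
  assume disj: "\<not> ?thesis"
  have "A \<noteq> {}" "B \<noteq> {}" "C \<noteq> {}" using large by auto
  hence distinct: "A \<noteq> B" "A \<noteq> C" "B \<noteq> C" using disj by blast+
  have "disjoint_family_on (\<lambda>N. N) {A, B, C}"
    using disj by (auto simp: disjoint_family_on_def)
  moreover have "card {A, B, C} = 3" using distinct by simp
  ultimately show False
    using not_disjoint_family_on_if_large[of V "{A, B, C}" "\<lambda>N. N"] V large by auto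
qed

lemma ex_subset_card_diff_one:
  assumes "r \<le> card V"
  shows "\<exists>S\<subseteq>V. card S = r - 1"
  using assms by (metis diff_le_self le_trans obtain_subset_with_card_n)

lemma periodic_add_mult:
  fixes f :: "nat \<Rightarrow> 'a"
  assumes "\<And>i. f (i + a) = f i"
  shows "f (i + m * a) = f i"
proof (induction m)
  case (Suc m)
  have "f (i + Suc m * a) = f ((i + m * a) + a)" by (simp add: algebra_simps)
  thus ?case using assms Suc by simp
qed simp

lemma periodic_gcd:
  fixes f :: "nat \<Rightarrow> 'a"
  assumes a: "\<And>i. f (i + a) = f i" and b: "\<And>i. f (i + b) = f i"
  shows "f (i + gcd a b) = f i"
proof (cases "a = 0")
  case True
  thus ?thesis using b by simp
next
  case False
  obtain x y where xy: "a * x = b * y + gcd a b" using bezout_nat[OF False] by blast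
  have "f (i + gcd a b) = f (i + gcd a b + y * b)" using periodic_add_mult[of f b, OF b] by simp
  also have "\<dots> = f (i + x * a)" using xy by (simp add: algebra_simps)
  finally show ?thesis using periodic_add_mult[of f a, OF a] by simp
qed

lemma sum_periodic:
  fixes f :: "nat \<Rightarrow> 'a::semiring_1"
  assumes "\<And>i. f (i + g) = f i"
  shows "(\<Sum>j<m * g. f j) = of_nat m * (\<Sum>j<g. f j)"
proof -
  have "(\<Sum>j<m * g. f j) = (\<Sum>i<m. \<Sum>j=i * g..<i * g + g. f j)" by (rule sum.nat_group[symmetric])
  also have "\<dots> = (\<Sum>i<m. \<Sum>j<g. f (j + i * g))"
    by (simp add: sum.atLeastLessThan_shift_0[of f] lessThan_atLeast0 add.commute)
  also have "\<dots> = (\<Sum>i<m. \<Sum>j<g. f j)" using periodic_add_mult[of f g, OF assms] by simp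
  finally show ?thesis by simp
qed

lemma dvd_sum_two_periods:
  fixes f :: "nat \<Rightarrow> nat"
  assumes "\<And>i. f (i + a) = f i" "\<And>i. f (i + b) = f i"
  shows "a div gcd a b dvd (\<Sum>j<a. f j)"
proof -
  have "(\<Sum>j<a. f j) = (\<Sum>j<(a div gcd a b) * gcd a b. f j)" by simp
  also have "\<dots> = (a div gcd a b) * (\<Sum>j<gcd a b. f j)"
    by (rule sum_periodic[of f, OF periodic_gcd[of f, OF assms], simplified])
  finally show ?thesis by simp
qed

lemma shift_mod_gcd:
  fixes j k r :: nat
  shows "(j + k) mod r mod gcd r k = j mod gcd r k"
  using mod_add_eq[of j "gcd r k" k] by (simp add: mod_mod_cancel)

lemma shift_invariant_card_dvd:
  assumes "r > 0" "M \<subseteq> {..<r}" and shift: "\<And>j. j < r \<Longrightarrow> (j + k) mod r \<in> M \<longleftrightarrow> j \<in> M"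
  shows "r div gcd r k dvd card M"
proof -
  define f :: "nat \<Rightarrow> nat" where "f j = of_bool (j mod r \<in> M)" for j
  have "f (j + k) = f j" for j
    using shift[of "j mod r"] \<open>r > 0\<close> by (simp add: f_def mod_add_left_eq)
  hence "r div gcd r k dvd (\<Sum>j<r. f j)" by (intro dvd_sum_two_periods) (simp_all add: f_def)
  also have "(\<Sum>j<r. f j) = card M"
    using \<open>M \<subseteq> {..<r}\<close> by (simp add: f_def sum.If_cases of_bool_def Int_absorb1)
  finally show ?thesis .
qed

lemma ex_shift_invariant_set:
  assumes "r > 0" "r div gcd r k dvd s" "s \<le> r"
  shows "\<exists>M\<subseteq>{..<r}. card M = s \<and> (\<forall>j<r. (j + k) mod r \<in> M \<longleftrightarrow> j \<in> M)"
proof -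
  define g where "g = gcd r k"
  have g: "g > 0" "r div g * g = r" using assms unfolding g_def by auto
  obtain c where c: "s = r div g * c" using assms unfolding g_def by blast
  have "r div g * c \<le> r div g * g" "r div g > 0" using c g assms by (auto intro: Nat.gr0I)
  hence "c \<le> g" by simp
  define M where "M = {j \<in> {..<r}. j mod g < c}"
  have "card M = (\<Sum>j<r div g * g. of_bool (j mod g < c))"
    unfolding M_def g(2) by (simp add: sum.If_cases of_bool_def Int_def)
  also have "\<dots> = r div g * (\<Sum>j<g. of_bool (j mod g < c))"
    using sum_periodic[of "\<lambda>j. of_bool (j mod g < c) :: nat" g] by simp
  also have "(\<Sum>j<g. of_bool (j mod g < c)) = (\<Sum>j<g. of_bool (j < c) :: nat)"
    by (intro sum.cong) auto
  also have "\<dots> = card ({..<g} \<inter> {..<c})" by (simp add: sum.If_cases of_bool_def lessThan_def)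
  also have "{..<g} \<inter> {..<c} = {..<c}" using \<open>c \<le> g\<close> by auto
  finally have "card M = s" using c by simp
  moreover have "(j + k) mod r \<in> M \<longleftrightarrow> j \<in> M" if "j < r" for j
    using shift_mod_gcd[of j k r] that unfolding M_def g_def by simp
  moreover have "M \<subseteq> {..<r}" unfolding M_def by blast
  ultimately show ?thesis by blast
qed

lemma ex_bij_betw_image_eq:
  assumes "finite A" "finite B" "P \<subseteq> A" "Q \<subseteq> B" "card A = card B" "card P = card Q"
  shows "\<exists>h. bij_betw h A B \<and> h ` P = Q"
proof -
  have fin: "finite P" "finite Q" using assms finite_subset by blast+
  obtain h1 where h1: "bij_betw h1 P Q" using finite_same_card_bij[OF fin] assms by blast
  have "card (A - P) = card (B - Q)" using assms fin by (simp add: card_Diff_subset)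
  then obtain h2 where h2: "bij_betw h2 (A - P) (B - Q)"
    using finite_same_card_bij assms by (metis finite_Diff)
  define h where "h x = (if x \<in> P then h1 x else h2 x)" for x
  have P: "bij_betw h P Q" using h1 by (rule bij_betw_cong[THEN iffD1, rotated]) (simp add: h_def)
  have "bij_betw h (A - P) (B - Q)"
    using h2 by (rule bij_betw_cong[THEN iffD1, rotated]) (simp add: h_def)
  from bij_betw_combine[OF P this] have "bij_betw h A B"
    using assms by (simp add: Un_absorb1)
  thus ?thesis using P unfolding bij_betw_def by blast
qed

lemma ex_permutes_image_eq:
  assumes "finite A" "P \<subseteq> A" "Q \<subseteq> A" "card P = card Q"
  shows "\<exists>h. h permutes A \<and> h ` P = Q"
proof -
  obtain h where h: "bij_betw h A A" "h ` P = Q"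
    using ex_bij_betw_image_eq[of A A P Q] assms by blast
  have "perm_restrict h A permutes A"
    using h(1) by (intro bij_imp_permutes) (simp_all add: perm_restrict_simps cong: bij_betw_cong)
  moreover have "perm_restrict h A ` P = Q"
    using h(2) assms by (auto simp: perm_restrict_def)
  ultimately show ?thesis by blast
qed

lemma perm_restrict_permutes:
  assumes "finite A" "p permutes S" "p ` A \<subseteq> A"
  shows "perm_restrict p A permutes A"
proof (rule bij_imp_permutes)
  have "bij_betw p A A"
    unfolding bij_betw_def using assms permutes_inj_on[OF assms(2)] by (simp add: endo_inj_surj)
  thus "bij_betw (perm_restrict p A) A A" by (simp add: perm_restrict_simps cong: bij_betw_cong)
qed (simp add: perm_restrict_simps)

locale perm_monoid =
  fixes K :: "('a \<Rightarrow> 'a) set"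
  assumes id_mem: "id \<in> K"
    and comp_mem: "\<And>p q. p \<in> K \<Longrightarrow> q \<in> K \<Longrightarrow> p \<circ> q \<in> K"
begin

lemma transpose_mem_trans:
  assumes "transpose a b \<in> K" "transpose b c \<in> K"
  shows "transpose a c \<in> K"
proof (cases "a = c \<or> b = c")
  case True
  thus ?thesis using assms id_mem by auto
next
  case False
  thus ?thesis using assms comp_mem transpose_comp_triple[of a c b] by metis
qed

lemma permutes_mem:
  assumes "finite A" "p permutes A"
    and "\<And>a b. a \<in> A \<Longrightarrow> b \<in> A \<Longrightarrow> transpose a b \<in> K"
  shows "p \<in> K"
  using assms(2,1)
proof (induction rule: permutes_induct)
  case id
  show ?case by (rule id_mem)
next
  case (swap a b p)
  thus ?case using assms(3) comp_mem by blast
qed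

lemma block_preserving_mem:
  assumes e: "finite e" "P \<subseteq> e" and p: "p permutes e" "p ` P \<subseteq> P"
    and transposes: "\<And>a b. a \<in> e \<Longrightarrow> b \<in> e \<Longrightarrow> (a \<in> P \<longleftrightarrow> b \<in> P) \<Longrightarrow> transpose a b \<in> K"
  shows "p \<in> K"
proof -
  have fin: "finite P" "finite (e - P)" using e finite_subset by auto
  have "p ` P = P" using endo_inj_surj[OF fin(1) p(2)] permutes_inj_on[OF p(1)] by blast
  hence "p ` (e - P) \<subseteq> e - P"
    using image_set_diff[OF permutes_inj[OF p(1)], of e P] permutes_image[OF p(1)] by simp
  hence restrict: "perm_restrict p P permutes P" "perm_restrict p (e - P) permutes (e - P)"
    using perm_restrict_permutes fin p by blast+
  have "perm_restrict p P \<in> K"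
    by (rule permutes_mem[OF fin(1) restrict(1)]) (use transposes e in blast)
  moreover have "perm_restrict p (e - P) \<in> K"
    by (rule permutes_mem[OF fin(2) restrict(2)]) (use transposes in blast)
  ultimately have "perm_restrict p P \<circ> perm_restrict p (e - P) \<in> K" by (rule comp_mem)
  also have "perm_restrict p P \<circ> perm_restrict p (e - P) = p"
    using perm_restrict_union[OF restrict] e p(1) by (simp add: Un_absorb1)
  finally show ?thesis .
qed

end

subsection \<open>Tight walks and replacements\<close>

definition nbrs :: "'a set set \<Rightarrow> 'a set \<Rightarrow> 'a set" where
  "nbrs E S = {v. v \<notin> S \<and> insert v S \<in> E}"

definition closed_tight_walk :: "nat \<Rightarrow> 'a set set \<Rightarrow> nat \<Rightarrow> (nat \<Rightarrow> 'a) \<Rightarrow> bool" where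
  "closed_tight_walk r E l x \<longleftrightarrow> (\<forall>i. x (i + l) = x i) \<and> (\<forall>i. x ` {i..<i + r} \<in> E)"

abbreviation cycle_hom_family :: "nat \<Rightarrow> nat \<Rightarrow> nat hypergraph set" where
  "cycle_hom_family r k \<equiv> hom_family r (tight_cycle_family r k)"

lemma hypergraph_hom_comp:
  assumes "hypergraph_hom \<phi> F G" "hypergraph_hom \<psi> G H"
  shows "hypergraph_hom (\<psi> \<circ> \<phi>) F H"
  using assms unfolding hypergraph_hom_def image_comp[symmetric] by blast

lemma family_free_hom_family_iff:
  fixes H :: "nat hypergraph"
  assumes H: "r_graph r H"
    and wf: "\<And>F. F \<in> \<F> \<Longrightarrow> finite (verts F) \<and> (\<forall>e\<in>edges F. e \<subseteq> verts F)"
  shows "family_free (hom_family r \<F>) H \<longleftrightarrow> (\<forall>F\<in>\<F>. \<forall>\<phi>. \<not> hypergraph_hom \<phi> F H)"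
proof
  assume free: "family_free (hom_family r \<F>) H"
  show "\<forall>F\<in>\<F>. \<forall>\<phi>. \<not> hypergraph_hom \<phi> F H"
  proof (intro ballI allI notI)
    fix F \<phi> assume F: "F \<in> \<F>" and hom: "hypergraph_hom \<phi> F H"
    define G where "G = \<lparr>verts = \<phi> ` verts F, edges = (\<lambda>e. \<phi> ` e) ` edges F\<rparr>"
    have "hypergraph_hom \<phi> F G" unfolding hypergraph_hom_def G_def by auto
    moreover have "r_graph r G"
      using H hom wf[OF F] unfolding r_graph_def hypergraph_hom_def G_def by fastforce
    ultimately have "G \<in> hom_family r \<F>"
      using F unfolding hom_family_def by (auto simp: G_def)
    moreover have "contains_copy H G"
      using hom unfolding contains_copy_def hypergraph_hom_def G_def
      by (intro exI[of _ id]) auto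
    ultimately show False using free unfolding family_free_def by blast
  qed
next
  assume no_hom: "\<forall>F\<in>\<F>. \<forall>\<phi>. \<not> hypergraph_hom \<phi> F H"
  show "family_free (hom_family r \<F>) H"
    unfolding family_free_def hom_family_def contains_copy_def
    using no_hom hypergraph_hom_comp by fast
qed

lemma image_shift_window:
  fixes x :: "nat \<Rightarrow> 'a"
  shows "(\<lambda>j. x (i + j)) ` {0..<r} = x ` {i..<i + r}"
proof -
  have "x ` {i..<i + r} = x ` (\<lambda>j. i + j) ` {0..<r}" by (simp add: add.commute)
  thus ?thesis unfolding image_image by (rule sym)
qed

lemma tight_cycle_hom_iff_closed_tight_walk:
  assumes H: "r_graph r H" and "r > 0" "l > 0"
  shows "(\<exists>\<phi>. hypergraph_hom \<phi> (tight_cycle r l) H) \<longleftrightarrow> (\<exists>x. closed_tight_walk r (edges H) l x)"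
proof -
  have window: "x ` (\<lambda>j. (i + j) mod l) ` {0..<r} = x ` {i..<i + r}"
    if "\<And>i. x (i mod l) = x i" for x :: "nat \<Rightarrow> 'a" and i
    using that by (simp add: image_image image_shift_window)
  show ?thesis
  proof
    assume "\<exists>\<phi>. hypergraph_hom \<phi> (tight_cycle r l) H"
    then obtain \<phi> where hom: "hypergraph_hom \<phi> (tight_cycle r l) H" by blast
    define x where "x i = \<phi> (i mod l)" for i
    have "x ` {i..<i + r} \<in> edges H" for i
    proof -
      have "(\<lambda>j. (i mod l + j) mod l) ` {0..<r} \<in> edges (tight_cycle r l)"
        unfolding tight_cycle_def using \<open>l > 0\<close> by force
      hence "\<phi> ` (\<lambda>j. (i + j) mod l) ` {0..<r} \<in> edges H"
        using hom unfolding hypergraph_hom_def by (simp add: mod_add_left_eq)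
      thus ?thesis using window[of x i] by (simp add: x_def image_image)
    qed
    thus "\<exists>x. closed_tight_walk r (edges H) l x"
      unfolding closed_tight_walk_def by (intro exI[of _ x]) (simp add: x_def)
  next
    assume "\<exists>x. closed_tight_walk r (edges H) l x"
    then obtain x where x: "\<And>i. x (i + l) = x i" "\<And>i. x ` {i..<i + r} \<in> edges H"
      unfolding closed_tight_walk_def by blast
    have "x (i mod l) = x i" for i
      using periodic_add_mult[of x l "i mod l" "i div l", OF x(1)] by simp
    hence "x ` e \<in> edges H" if "e \<in> edges (tight_cycle r l)" for e
      using that window x(2) unfolding tight_cycle_def by auto
    moreover have "x i \<in> verts H" for i
      using H x(2)[of i] \<open>r > 0\<close> unfolding r_graph_def by fastforce
    ultimately show "\<exists>\<phi>. hypergraph_hom \<phi> (tight_cycle r l) H"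
      unfolding hypergraph_hom_def by blast
  qed
qed

lemma family_free_iff_no_closed_tight_walk:
  fixes H :: "nat hypergraph"
  assumes "r_graph r H" "r > 0"
  shows "family_free (cycle_hom_family r k) H \<longleftrightarrow>
    (\<forall>l x. r < l \<longrightarrow> [l = k] (mod r) \<longrightarrow> \<not> closed_tight_walk r (edges H) l x)"
proof -
  have "family_free (cycle_hom_family r k) H \<longleftrightarrow>
      (\<forall>F\<in>tight_cycle_family r k. \<forall>\<phi>. \<not> hypergraph_hom \<phi> F H)"
    using assms(1)
    by (rule family_free_hom_family_iff) (auto simp: tight_cycle_family_def tight_cycle_def)
  also have "\<dots> \<longleftrightarrow>
      (\<forall>l. r < l \<longrightarrow> [l = k] (mod r) \<longrightarrow> \<not> (\<exists>\<phi>. hypergraph_hom \<phi> (tight_cycle r l) H))"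
    unfolding tight_cycle_family_def by blast
  also have "\<dots> \<longleftrightarrow>
      (\<forall>l. r < l \<longrightarrow> [l = k] (mod r) \<longrightarrow> \<not> (\<exists>x. closed_tight_walk r (edges H) l x))"
    using tight_cycle_hom_iff_closed_tight_walk[OF assms]
    by (metis gr_implies_not0 not_gr_zero)
  finally show ?thesis by blast
qed

text \<open>Ordered edges are lists of length \<open>r\<close> whose elements form an edge; as edges have \<open>r\<close> elements,
  these lists are distinct.\<close>

definition tight_step :: "'a set set \<Rightarrow> ('a list \<times> 'a list) set" where
  "tight_step E = {(xs, tl xs @ [v]) | xs v. xs \<noteq> [] \<and> set xs \<in> E \<and> set (tl xs @ [v]) \<in> E}"

definition replacement :: "'a set set \<Rightarrow> ('a list \<times> 'a list) set" where
  "replacement E = {(xs, xs[j := v]) | xs j v. j < length xs \<and> set xs \<in> E \<and> set (xs[j := v]) \<in> E}"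

lemma tight_step_sequence_nth:
  assumes steps: "\<And>i. (F i, F (Suc i)) \<in> tight_step E" and j: "j < length (F i)"
  shows "F i ! j = hd (F (i + j))"
  using j
proof (induction j arbitrary: i)
  case 0
  thus ?case by (simp add: hd_conv_nth)
next
  case (Suc j)
  obtain v where v: "F (Suc i) = tl (F i) @ [v]"
    using steps[of i] unfolding tight_step_def by auto
  have "j < length (F (Suc i))" using v Suc.prems by simp
  moreover have "F i ! Suc j = F (Suc i) ! j"
    using v Suc.prems by (simp add: nth_append nth_tl less_diff_conv)
  ultimately show ?case using Suc.IH[of "Suc i"] by simp
qed

lemma closed_tight_walk_of_tight_steps:
  assumes closed: "(xs, xs) \<in> tight_step E ^^ l" and "l > 0"
  shows "\<exists>x. closed_tight_walk (length xs) E l x"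
proof -
  obtain f where f: "f 0 = xs" "f l = xs" "\<And>i. i < l \<Longrightarrow> (f i, f (Suc i)) \<in> tight_step E"
    using closed unfolding relpow_fun_conv by blast
  define F where "F i = f (i mod l)" for i
  have steps: "(F i, F (Suc i)) \<in> tight_step E" for i
  proof -
    have "F (Suc i) = f (Suc (i mod l))"
      using f(1,2) by (simp add: F_def mod_Suc)
    thus ?thesis using f(3)[of "i mod l"] \<open>l > 0\<close> by (simp add: F_def)
  qed
  have length: "length (F i) = length xs" for i
  proof (induction i)
    case (Suc i)
    thus ?case using steps[of i] unfolding tight_step_def by (auto simp flip: length_greater_0_conv)
  qed (use f(1) in \<open>simp add: F_def\<close>)
  have "(\<lambda>i. hd (F i)) ` {i..<i + length xs} = set (F i)" for i
  proof -
    have "(\<lambda>i. hd (F i)) ` {i..<i + length xs} = (\<lambda>j. F i ! j) ` {0..<length xs}"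
      unfolding image_shift_window[symmetric]
      using tight_step_sequence_nth[of F, OF steps] length by (intro image_cong) simp_all
    also have "\<dots> = set (F i)" using length[of i] by (auto simp: set_conv_nth)
    finally show ?thesis .
  qed
  moreover have "set (F i) \<in> E" for i using steps[of i] unfolding tight_step_def by auto
  ultimately have "closed_tight_walk (length xs) E l (\<lambda>i. hd (F i))"
    unfolding closed_tight_walk_def by (simp add: F_def)
  thus ?thesis by blast
qed

lemma tight_steps_rotate:
  assumes "xs \<noteq> []" "set xs \<in> E"
  shows "(xs, rotate n xs) \<in> tight_step E ^^ n"
proof (induction n)
  case (Suc n)
  have "rotate (Suc n) xs = tl (rotate n xs) @ [hd (rotate n xs)]"
    using assms by (simp add: rotate1_hd_tl)
  moreover have "set (rotate (Suc n) xs) \<in> E" using assms by (simp del: rotate_Suc)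
  ultimately have "(rotate n xs, rotate (Suc n) xs) \<in> tight_step E"
    using assms unfolding tight_step_def by force
  with Suc show ?case by auto
qed simp

lemma tight_steps_of_replacement:
  assumes "(xs, ys) \<in> replacement E"
  shows "(xs, ys) \<in> tight_step E ^^ length xs"
proof -
  obtain j v where j: "j < length xs" "ys = xs[j := v]" and E: "set xs \<in> E" "set ys \<in> E"
    using assms unfolding replacement_def by auto
  have "rotate j xs = xs ! j # drop (Suc j) xs @ take j xs"
    using j by (simp add: rotate_drop_take Cons_nth_drop_Suc)
  moreover have "rotate j ys = v # drop (Suc j) xs @ take j xs"
    using j by (simp add: rotate_drop_take drop_update_swap flip: Cons_nth_drop_Suc)
  ultimately have "rotate (Suc j) ys = tl (rotate j xs) @ [v]" by simp
  moreover have "set (rotate (Suc j) ys) \<in> E" using E by (simp del: rotate_Suc)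
  ultimately have step: "(rotate j xs, rotate (Suc j) ys) \<in> tight_step E"
    using j E unfolding tight_step_def by fastforce
  have "(rotate (Suc j) ys, rotate (length xs - Suc j) (rotate (Suc j) ys)) \<in>
      tight_step E ^^ (length xs - Suc j)"
    using j E by (intro tight_steps_rotate) auto
  also have "rotate (length xs - Suc j) (rotate (Suc j) ys) = rotate (length ys) ys"
    unfolding rotate_rotate using j by (subst le_add_diff_inverse2) simp_all
  also have "\<dots> = ys" by (simp add: rotate_id)
  finally have "(rotate (Suc j) ys, ys) \<in> tight_step E ^^ (length xs - Suc j)" .
  moreover have "(xs, rotate j xs) \<in> tight_step E ^^ j"
    using j E by (intro tight_steps_rotate) auto
  hence "(xs, rotate (Suc j) ys) \<in> tight_step E ^^ Suc j" using step by (rule relpow_Suc_I)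
  ultimately have "(xs, ys) \<in> tight_step E ^^ (Suc j + (length xs - Suc j))"
    unfolding relpow_add by blast
  moreover have "Suc j + (length xs - Suc j) = length xs" using j by simp
  ultimately show ?thesis by (simp only:)
qed

lemma tight_steps_of_replacements:
  assumes "(xs, ys) \<in> (replacement E)\<^sup>*"
  shows "\<exists>m. (xs, ys) \<in> tight_step E ^^ (m * length xs)"
  using assms
proof (induction rule: converse_rtrancl_induct)
  case base
  show ?case by (rule exI[of _ 0]) simp
next
  case (step xs zs)
  then obtain m where "(zs, ys) \<in> tight_step E ^^ (m * length zs)" by blast
  moreover have "length zs = length xs" using step.hyps unfolding replacement_def by auto
  ultimately have "(xs, ys) \<in> tight_step E ^^ (length xs + m * length xs)"
    using tight_steps_of_replacement[OF step.hyps(1)] unfolding relpow_add by auto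
  thus ?case by (intro exI[of _ "Suc m"]) simp
qed

lemma sym_replacement: "sym (replacement E)"
proof (rule symI)
  fix xs ys assume "(xs, ys) \<in> replacement E"
  then obtain j v where j: "j < length xs" "ys = xs[j := v]" and E: "set xs \<in> E" "set ys \<in> E"
    unfolding replacement_def by auto
  hence "j < length ys" "set (ys[j := xs ! j]) \<in> E" by simp_all
  hence "(ys, ys[j := xs ! j]) \<in> replacement E" using E unfolding replacement_def by blast
  thus "(ys, xs) \<in> replacement E" using j by simp
qed

lemma not_free_of_replacements_rotate:
  fixes H :: "nat hypergraph"
  assumes H: "r_graph r H" and xs: "xs \<noteq> []" "set xs \<in> edges H" "length xs = r"
    and repl: "(xs, rotate k xs) \<in> (replacement (edges H))\<^sup>*"
  shows "\<not> family_free (cycle_hom_family r k) H"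
proof -
  let ?R = "tight_step (edges H)"
  have "(rotate k xs, xs) \<in> (replacement (edges H))\<^sup>*"
    using repl sym_rtrancl[OF sym_replacement] by (rule symD[rotated])
  then obtain m where return_steps: "(rotate k xs, xs) \<in> ?R ^^ (m * r)"
    using tight_steps_of_replacements xs(3) by fastforce
  have "rotate (2 * r) xs = xs" using xs(3) by (simp add: rotate_id)
  hence "(xs, xs) \<in> ?R ^^ (2 * r)" using tight_steps_rotate[OF xs(1,2)] by metis
  hence "(xs, xs) \<in> ?R ^^ (2 * r + (k + m * r))"
    unfolding relpow_add using tight_steps_rotate[OF xs(1,2), of k] return_steps by blast
  moreover have r: "r > 0" using xs by auto
  ultimately obtain x where "closed_tight_walk r (edges H) (2 * r + (k + m * r)) x"
    using closed_tight_walk_of_tight_steps xs(3) by fastforce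
  moreover have "[2 * r + (k + m * r) = k] (mod r)" by (simp add: Cong.cong_def)
  ultimately show ?thesis
    using family_free_iff_no_closed_tight_walk[OF H r] r by fastforce
qed

definition reachable_perms :: "'a set set \<Rightarrow> 'a set \<Rightarrow> ('a \<Rightarrow> 'a) set" where
  "reachable_perms E e = {p. p permutes e \<and>
     (\<forall>xs. distinct xs \<longrightarrow> set xs = e \<longrightarrow> (xs, map p xs) \<in> (replacement E)\<^sup>*)}"

lemma perm_monoid_reachable_perms: "perm_monoid (reachable_perms E e)"
proof
  show "id \<in> reachable_perms E e" unfolding reachable_perms_def by (simp add: permutes_id)
next
  fix p q assume p: "p \<in> reachable_perms E e" and q: "q \<in> reachable_perms E e"
  have "(xs, map (p \<circ> q) xs) \<in> (replacement E)\<^sup>*" if xs: "distinct xs" "set xs = e" for xs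
  proof -
    have "q permutes e" using q unfolding reachable_perms_def by simp
    hence "distinct (map q xs)" "set (map q xs) = e"
      using xs by (auto simp: distinct_map permutes_inj_on permutes_image)
    hence "(map q xs, map p (map q xs)) \<in> (replacement E)\<^sup>*"
      using p unfolding reachable_perms_def by blast
    moreover have "(xs, map q xs) \<in> (replacement E)\<^sup>*"
      using q xs unfolding reachable_perms_def by blast
    ultimately show ?thesis by simp
  qed
  thus "p \<circ> q \<in> reachable_perms E e"
    using p q permutes_compose unfolding reachable_perms_def by blast
qed

lemma ex_ordering_rotation_preserves:
  assumes e: "finite e" "card e = r" "r > 0" and P: "P \<subseteq> e" "r div gcd r k dvd card P"
  shows "\<exists>xs. distinct xs \<and> set xs = e \<and> (cycle_of_list xs ^^ k) ` P \<subseteq> P"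
proof -
  have "card P \<le> r" using e P card_mono by blast
  then obtain M where M: "M \<subseteq> {..<r}" "card M = card P"
    and shift: "\<And>j. j < r \<Longrightarrow> (j + k) mod r \<in> M \<longleftrightarrow> j \<in> M"
    using ex_shift_invariant_set[OF \<open>r > 0\<close> P(2)] by blast
  obtain h where h: "bij_betw h {..<r} e" "h ` M = P"
    using ex_bij_betw_image_eq[of "{..<r}" e M P] e P M by auto
  define xs where "xs = map h [0..<r]"
  have xs: "distinct xs" "set xs = e" "length xs = r"
    using h(1) unfolding xs_def bij_betw_def by (auto simp: distinct_map lessThan_atLeast0)
  have "(cycle_of_list xs ^^ k) (h j) = h ((j + k) mod r)" if "j < r" for j
  proof -
    have "map (cycle_of_list xs ^^ k) xs ! j = rotate k xs ! j"
      using cyclic_rotation[OF xs(1)] by simp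
    thus ?thesis using that xs(3) \<open>r > 0\<close> by (simp add: nth_rotate xs_def add.commute)
  qed
  moreover have "h ((j + k) mod r) \<in> P" if "j \<in> M" for j
    using that shift[of j] M(1) h(2) by blast
  ultimately have "(cycle_of_list xs ^^ k) ` P \<subseteq> P"
    using M(1) unfolding h(2)[symmetric] by (auto simp: subset_iff)
  thus ?thesis using xs by blast
qed

lemma not_free_of_reachable_block:
  fixes H :: "nat hypergraph"
  assumes H: "r_graph r H" "r > 0" and e: "e \<in> edges H"
    and P: "P \<subseteq> e" "r div gcd r k dvd card P"
    and transposes: "\<And>a b. a \<in> e \<Longrightarrow> b \<in> e \<Longrightarrow> (a \<in> P \<longleftrightarrow> b \<in> P) \<Longrightarrow>
      transpose a b \<in> reachable_perms (edges H) e"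
  shows "\<not> family_free (cycle_hom_family r k) H"
proof -
  have card_e: "finite e" "card e = r"
    using H e finite_subset unfolding r_graph_def by blast+
  obtain xs where xs: "distinct xs" "set xs = e" "(cycle_of_list xs ^^ k) ` P \<subseteq> P"
    using ex_ordering_rotation_preserves[OF card_e H(2) P] by blast
  have "cycle_of_list xs ^^ k permutes e"
    using permutes_funpow[OF cycle_permutes] xs(2) by metis
  hence "cycle_of_list xs ^^ k \<in> reachable_perms (edges H) e"
    by (rule perm_monoid.block_preserving_mem[OF perm_monoid_reachable_perms card_e(1) P(1) _ xs(3)])
      (rule transposes)
  hence "(xs, map (cycle_of_list xs ^^ k) xs) \<in> (replacement (edges H))\<^sup>*"
    using xs(1,2) unfolding reachable_perms_def by blast
  hence "(xs, rotate k xs) \<in> (replacement (edges H))\<^sup>*"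
    by (simp only: cyclic_rotation[OF xs(1)])
  moreover have "length xs = r" "xs \<noteq> []"
    using xs card_e(2) distinct_card[OF xs(1)] H(2) by auto
  ultimately show ?thesis
    using not_free_of_replacements_rotate[OF H(1)] xs(2) e by blast
qed

subsection \<open>Reversing an edge of a graph\<close>

definition bipartite :: "('a \<times> 'a) set \<Rightarrow> bool" where
  "bipartite G \<longleftrightarrow> (\<exists>U. \<forall>(u, v)\<in>G. u \<in> U \<longleftrightarrow> v \<notin> U)"

definition edge_move :: "('a \<times> 'a) set \<Rightarrow> (('a \<times> 'a) \<times> ('a \<times> 'a)) set" where
  "edge_move G = {((u, v), (u', v')). (u, v) \<in> G \<and> (u', v') \<in> G \<and> (u = u' \<or> v = v')}"

lemma not_bipartite_triangle:
  assumes "(a, b) \<in> G" "(b, c) \<in> G" "(a, c) \<in> G"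
  shows "\<not> bipartite G"
proof
  assume "bipartite G"
  then obtain U where U: "\<forall>(u, v)\<in>G. u \<in> U \<longleftrightarrow> v \<notin> U" unfolding bipartite_def ..
  show False using bspec[OF U assms(1)] bspec[OF U assms(2)] bspec[OF U assms(3)] by auto
qed

lemma sym_edge_move: "sym (edge_move G)"
  unfolding sym_def edge_move_def by auto

lemma edge_moves_flip:
  assumes "sym G" "((a, b), (u, v)) \<in> (edge_move G)\<^sup>*"
  shows "((b, a), (v, u)) \<in> (edge_move G)\<^sup>*"
  using assms(2)
proof (induction "(u, v)" arbitrary: u v rule: rtrancl_induct)
  case base
  show ?case by simp
next
  case (step p)
  obtain u' v' where p: "p = (u', v')" by fastforce
  have "((v', u'), (v, u)) \<in> edge_move G"
    using step.hyps(2) \<open>sym G\<close> unfolding p edge_move_def by (auto dest: symD)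
  thus ?case using step.hyps(3)[OF p] by (rule rtrancl.rtrancl_into_rtrancl[rotated])
qed

definition reachable_edges :: "('a \<times> 'a) set \<Rightarrow> 'a \<times> 'a \<Rightarrow> ('a \<times> 'a) set" where
  "reachable_edges G p = {q \<in> G. (p, q) \<in> (edge_move G)\<^sup>*}"

lemma reachable_edges_move_snd:
  assumes "u \<in> Domain (reachable_edges G p)" "(u, v) \<in> G"
  shows "(u, v) \<in> reachable_edges G p"
proof -
  obtain w where "(u, w) \<in> G" "(p, (u, w)) \<in> (edge_move G)\<^sup>*"
    using assms(1) unfolding reachable_edges_def by blast
  moreover from this have "((u, w), (u, v)) \<in> edge_move G"
    using assms(2) unfolding edge_move_def by auto
  ultimately show ?thesis
    using assms(2) unfolding reachable_edges_def by (auto intro: rtrancl_into_rtrancl)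
qed

lemma reachable_edges_move_fst:
  assumes "v \<in> Range (reachable_edges G p)" "(u, v) \<in> G"
  shows "(u, v) \<in> reachable_edges G p"
proof -
  obtain w where "(w, v) \<in> G" "(p, (w, v)) \<in> (edge_move G)\<^sup>*"
    using assms(1) unfolding reachable_edges_def by blast
  moreover from this have "((w, v), (u, v)) \<in> edge_move G"
    using assms(2) unfolding edge_move_def by auto
  ultimately show ?thesis
    using assms(2) unfolding reachable_edges_def by (auto intro: rtrancl_into_rtrancl)
qed

lemma edge_reversal_if_sides_meet:
  assumes "sym G"
    and meet: "Domain (reachable_edges G (a, b)) \<inter> Range (reachable_edges G (a, b)) \<noteq> {}"
  shows "((a, b), (b, a)) \<in> (edge_move G)\<^sup>*"
proof -
  obtain u v where u: "u \<in> Range (reachable_edges G (a, b))"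
    and uv: "(u, v) \<in> reachable_edges G (a, b)"
    using meet by blast
  have "(v, u) \<in> G" using uv \<open>sym G\<close> unfolding reachable_edges_def by (auto dest: symD)
  hence "((a, b), (v, u)) \<in> (edge_move G)\<^sup>*"
    using reachable_edges_move_fst[OF u] unfolding reachable_edges_def by blast
  also have "((b, a), (v, u)) \<in> (edge_move G)\<^sup>*"
    using uv unfolding reachable_edges_def by (auto intro: edge_moves_flip[OF \<open>sym G\<close>])
  hence "((v, u), (b, a)) \<in> (edge_move G)\<^sup>*" by (rule symD[OF sym_rtrancl[OF sym_edge_move]])
  finally show ?thesis .
qed

text \<open>The first and the second ends of the edges reachable from \<open>(a, b)\<close> form the two sides of a
  component of \<open>G\<close>. If they are disjoint, this component has more than two thirds of the vertices,
  which leaves no room for a further component.\<close>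

lemma edge_reversal_reachable:
  assumes G: "sym G" "G \<subseteq> W \<times> W" "\<not> bipartite G" and W: "finite W"
    and degree: "\<And>w. w \<in> W \<Longrightarrow> card W < 3 * card (G `` {w})"
    and ab: "(a, b) \<in> G"
  shows "((a, b), (b, a)) \<in> (edge_move G)\<^sup>*"
proof (rule ccontr)
  assume irreversible: "((a, b), (b, a)) \<notin> (edge_move G)\<^sup>*"
  define U U' where "U = Domain (reachable_edges G (a, b))"
    and "U' = Range (reachable_edges G (a, b))"
  have disjoint: "U \<inter> U' = {}"
    using edge_reversal_if_sides_meet[OF \<open>sym G\<close>] irreversible unfolding U_def U'_def by blast
  have "(a, b) \<in> reachable_edges G (a, b)" using ab unfolding reachable_edges_def by simp
  hence ends: "a \<in> U" "b \<in> U'" unfolding U_def U'_def by auto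
  have nbr_U: "v \<in> U'" if "u \<in> U" "(u, v) \<in> G" for u v
    using reachable_edges_move_snd that unfolding U_def U'_def by fast
  have nbr_U': "v \<in> U" if "u \<in> U'" "(u, v) \<in> G" for u v
    using reachable_edges_move_fst symD[OF \<open>sym G\<close> that(2)] that(1) unfolding U_def U'_def by fast
  have cover: "w \<in> U \<union> U'" if "w \<in> W" for w
  proof (rule ccontr)
    assume w: "w \<notin> U \<union> U'"
    have "G `` {a} \<subseteq> U'" "G `` {b} \<subseteq> U" "G `` {w} \<inter> (U \<union> U') = {}"
      using ends nbr_U nbr_U' w \<open>sym G\<close> by (auto dest: symD)
    moreover have "G `` {c} \<subseteq> W" for c using G(2) by blast
    ultimately show False
      using three_large_sets_meet[of W "G `` {a}" "G `` {b}" "G `` {w}"]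
        degree[of a] degree[of b] degree[of w] disjoint W G(2) ab \<open>w \<in> W\<close> by blast
  qed
  have "\<forall>(u, v)\<in>G. u \<in> U \<longleftrightarrow> v \<notin> U" using nbr_U nbr_U' disjoint cover G(2) by blast
  thus False using \<open>\<not> bipartite G\<close> unfolding bipartite_def by blast
qed

subsection \<open>Codegrees above one third\<close>

definition link :: "'a set set \<Rightarrow> 'a set \<Rightarrow> ('a \<times> 'a) set" where
  "link E T = {(u, v). u \<notin> T \<and> v \<notin> T \<and> u \<noteq> v \<and> insert u (insert v T) \<in> E}"

lemma sym_link: "sym (link E T)"
  unfolding sym_def link_def by (auto simp: insert_commute)

lemma link_Image: "u \<notin> T \<Longrightarrow> link E T `` {u} = nbrs E (insert u T)"
  unfolding link_def nbrs_def by (auto simp: insert_commute)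

lemma replacement_middle:
  assumes "set (as @ u # bs) \<in> E" "set (as @ v # bs) \<in> E"
  shows "(as @ u # bs, as @ v # bs) \<in> replacement E"
proof -
  have "(as @ u # bs, (as @ u # bs)[length as := v]) \<in> replacement E"
    unfolding replacement_def using assms
    by (intro CollectI exI[of _ "as @ u # bs"] exI[of _ "length as"] exI[of _ v]) simp
  thus ?thesis by simp
qed

lemma replacements_of_edge_moves:
  assumes "((u, v), (u', v')) \<in> (edge_move (link E (set (as @ bs @ cs))))\<^sup>*"
  shows "(as @ u # bs @ v # cs, as @ u' # bs @ v' # cs) \<in> (replacement E)\<^sup>*"
  using assms
proof (induction "(u', v')" arbitrary: u' v' rule: rtrancl_induct)
  case base
  show ?case by simp
next
  case (step p)
  obtain u1 v1 where p: "p = (u1, v1)" by fastforce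
  have "insert u1 (insert v1 (set (as @ bs @ cs))) \<in> E"
    "insert u' (insert v' (set (as @ bs @ cs))) \<in> E"
    using step.hyps(2) unfolding p edge_move_def link_def by auto
  hence edges: "set (as @ u1 # bs @ v1 # cs) \<in> E" "set (as @ u' # bs @ v' # cs) \<in> E"
    by (simp_all add: insert_commute)
  consider (move_fst) "v1 = v'" | (move_snd) "u1 = u'"
    using step.hyps(2) unfolding p edge_move_def by auto
  hence "(as @ u1 # bs @ v1 # cs, as @ u' # bs @ v' # cs) \<in> replacement E"
  proof cases
    case move_fst
    thus ?thesis using replacement_middle[of as u1 "bs @ v1 # cs" E u'] edges by simp
  next
    case move_snd
    thus ?thesis using replacement_middle[of "as @ u1 # bs" v1 cs E v'] edges by simp
  qed
  thus ?case using step.hyps(3)[OF p] by (rule rtrancl_into_rtrancl[rotated])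
qed

lemma replacements_transpose_of_edge_reversal:
  assumes xs: "distinct xs" "set xs = e" and ab: "a \<in> e" "b \<in> e" "a \<noteq> b"
    and reversal: "((a, b), (b, a)) \<in> (edge_move (link E (e - {a, b})))\<^sup>*"
  shows "(xs, map (transpose a b) xs) \<in> (replacement E)\<^sup>*"
proof -
  have split: ?thesis
    if "xs = as @ c # bs @ d # cs" "{c, d} = {a, b}"
      and "((c, d), (d, c)) \<in> (edge_move (link E (e - {a, b})))\<^sup>*" for as bs cs c d
  proof -
    have "e - {a, b} = set (as @ bs @ cs)" using xs that(1,2) by auto
    moreover have "transpose a b = transpose c d"
      using that(2) by (auto simp: doubleton_eq_iff transpose_commute)
    moreover have "map (transpose c d) xs = as @ d # bs @ c # cs"
      using xs(1) unfolding that(1) by (auto intro!: map_idI transpose_apply_other)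
    ultimately show ?thesis
      using replacements_of_edge_moves[of c d d c E as bs cs] that by simp
  qed
  obtain ys zs where yz: "xs = ys @ a # zs" using ab(1) xs(2) by (metis split_list)
  hence "b \<in> set zs \<or> b \<in> set ys" using ab xs(2) by auto
  thus ?thesis
  proof
    assume "b \<in> set zs"
    then obtain bs cs where "zs = bs @ b # cs" by (metis split_list)
    thus ?thesis using split[of ys a bs b cs] yz reversal by simp
  next
    assume "b \<in> set ys"
    then obtain as bs where "ys = as @ b # bs" by (metis split_list)
    thus ?thesis
      using split[of as b bs a zs] yz edge_moves_flip[OF sym_link reversal] by auto
  qed
qed

locale codegree_gt_third =
  fixes V :: "'a set" and E :: "'a set set" and r :: nat
  assumes finite_V: "finite V"
    and edge_subset: "\<And>e. e \<in> E \<Longrightarrow> e \<subseteq> V"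
    and edge_card: "\<And>e. e \<in> E \<Longrightarrow> card e = r"
    and codegree: "\<And>S. S \<subseteq> V \<Longrightarrow> card S = r - 1 \<Longrightarrow> card V < 3 * card (nbrs E S)"
begin

lemma nbrs_subset: "nbrs E S \<subseteq> V"
  using edge_subset unfolding nbrs_def by blast

lemma nbrs_mem: "v \<in> nbrs E S \<Longrightarrow> v \<in> V - S"
  using edge_subset unfolding nbrs_def by blast

lemma finite_edge: "e \<in> E \<Longrightarrow> finite e"
  using edge_subset finite_V finite_subset by blast

lemma ex_edge:
  assumes "r \<le> card V"
  shows "E \<noteq> {}"
proof -
  obtain S where "S \<subseteq> V" "card S = r - 1"
    using ex_subset_card_diff_one[OF assms] by blast
  from codegree[OF this] have "nbrs E S \<noteq> {}" by auto
  thus ?thesis unfolding nbrs_def by blast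
qed

lemma codegree_edge_minus:
  assumes "e \<in> E" "a \<in> e"
  shows "card V < 3 * card (nbrs E (e - {a}))"
  using assms edge_subset[of e] edge_card[of e] finite_edge[of e] by (intro codegree) auto

lemma nbrs_three_meet:
  assumes "\<And>S. S \<in> {A, B, C} \<Longrightarrow> S \<subseteq> V \<and> card S = r - 1"
  shows "nbrs E A \<inter> nbrs E B \<noteq> {} \<or> nbrs E A \<inter> nbrs E C \<noteq> {} \<or> nbrs E B \<inter> nbrs E C \<noteq> {}"
  using assms codegree by (intro three_large_sets_meet[OF finite_V] nbrs_subset) simp_all

lemma transpose_reachable:
  assumes e: "e \<in> E" "a \<in> e" "b \<in> e" "a \<noteq> b"
    and not_bipartite: "\<not> bipartite (link E (e - {a, b}))"
  shows "transpose a b \<in> reachable_perms E e"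
proof -
  define T where "T = e - {a, b}"
  have e_eq: "e = insert a (insert b T)" "a \<notin> T" "b \<notin> T" unfolding T_def using e by auto
  have T: "T \<subseteq> V" "finite T" "card T + 2 = r"
    using e_eq e(4) edge_subset[OF e(1)] edge_card[OF e(1)] finite_edge[OF e(1)] by auto
  have "((a, b), (b, a)) \<in> (edge_move (link E T))\<^sup>*"
  proof (rule edge_reversal_reachable[of _ "V - T"])
    show "link E T \<subseteq> (V - T) \<times> (V - T)" unfolding link_def using edge_subset by blast
    show "card (V - T) < 3 * card (link E T `` {w})" if "w \<in> V - T" for w
    proof -
      have "card V < 3 * card (nbrs E (insert w T))" using that T by (intro codegree) auto
      thus ?thesis using that link_Image[of w T E] card_mono[OF finite_V, of "V - T"] by force
    qed
    show "(a, b) \<in> link E T" using e e_eq unfolding link_def by blast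
  qed (use sym_link not_bipartite finite_V in \<open>auto simp: T_def\<close>)
  hence "(xs, map (transpose a b) xs) \<in> (replacement E)\<^sup>*" if "distinct xs" "set xs = e" for xs
    using replacements_transpose_of_edge_reversal[OF that e(2-4)] unfolding T_def by blast
  moreover have "transpose a b permutes e" using e by (simp add: permutes_swap_id)
  ultimately show ?thesis unfolding reachable_perms_def by simp
qed

lemma not_bipartite_link_of_common_nbr:
  assumes e: "e \<in> E" "a \<in> e" "b \<in> e" "a \<noteq> b"
    and c: "c \<in> nbrs E (e - {a})" "c \<in> nbrs E (e - {b})"
  shows "\<not> bipartite (link E (e - {a, b}))"
proof (rule not_bipartite_triangle)
  have "c \<noteq> a" "c \<noteq> b" "c \<notin> e" using c e unfolding nbrs_def by auto
  moreover have "insert a (insert b (e - {a, b})) = e"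
    "insert b (insert c (e - {a, b})) = insert c (e - {a})"
    "insert a (insert c (e - {a, b})) = insert c (e - {b})" using e by auto
  ultimately show "(a, b) \<in> link E (e - {a, b})" "(b, c) \<in> link E (e - {a, b})"
    "(a, c) \<in> link E (e - {a, b})"
    using e c unfolding link_def nbrs_def by auto
qed

lemma one_of_three_links_not_bipartite:
  assumes e: "e \<in> E" "a \<in> e" "b \<in> e" "c \<in> e" "distinct [a, b, c]"
  shows "\<not> bipartite (link E (e - {a, b})) \<or> \<not> bipartite (link E (e - {a, c})) \<or>
    \<not> bipartite (link E (e - {b, c}))"
proof -
  let ?N = "\<lambda>a. nbrs E (e - {a})"
  have "?N a \<inter> ?N b \<noteq> {} \<or> ?N a \<inter> ?N c \<noteq> {} \<or> ?N b \<inter> ?N c \<noteq> {}"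
    using e codegree_edge_minus by (intro three_large_sets_meet[OF finite_V] nbrs_subset) auto
  thus ?thesis using not_bipartite_link_of_common_nbr[OF e(1)] e(2-5) by fastforce
qed

end

subsection \<open>Colourings with two blocks\<close>

text \<open>The last assumption says that in every edge \<open>e\<close> the relation \<open>red (e - {a, b})\<close> between
  vertices \<open>a\<close> and \<open>b\<close> is an equivalence relation with at most two classes.\<close>

locale two_block_colouring = codegree_gt_third V E r
  for V :: "'a set" and E :: "'a set set" and r :: nat +
  fixes red :: "'a set \<Rightarrow> bool"
  assumes three_le_r: "3 \<le> r" and r_le_card: "r \<le> card V"
    and red_triple: "\<And>e a b c. e \<in> E \<Longrightarrow> a \<in> e \<Longrightarrow> b \<in> e \<Longrightarrow> c \<in> e \<Longrightarrow> distinct [a, b, c] \<Longrightarrow>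
      red (e - {a, b}) \<longleftrightarrow> (red (e - {a, c}) \<longleftrightarrow> red (e - {b, c}))"
begin

lemma ex_nbr_neq:
  assumes "S \<subseteq> V" "card S = r - 1"
  shows "\<exists>v\<in>nbrs E S. v \<noteq> y"
proof (rule ccontr)
  assume "\<not> ?thesis"
  hence "card (nbrs E S) \<le> card {y}" by (intro card_mono) auto
  thus False using codegree[OF assms] three_le_r r_le_card by simp
qed

lemma red_insert:
  assumes E: "insert a (insert b (insert c W)) \<in> E"
    and W: "distinct [a, b, c]" "a \<notin> W" "b \<notin> W" "c \<notin> W"
  shows "red (insert c W) \<longleftrightarrow> (red (insert a W) \<longleftrightarrow> red (insert b W))"
proof -
  let ?e = "insert a (insert b (insert c W))"
  have "?e - {a, b} = insert c W" "?e - {a, c} = insert b W" "?e - {b, c} = insert a W"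
    using W by auto
  thus ?thesis using red_triple[OF E, of a b c] W by auto
qed

definition block :: "'a set \<Rightarrow> 'a set \<Rightarrow> bool" where
  "block e P \<longleftrightarrow> e \<in> E \<and> P \<subseteq> e \<and>
     (\<forall>a\<in>e. \<forall>b\<in>e. a \<noteq> b \<longrightarrow> (red (e - {a, b}) \<longleftrightarrow> (a \<in> P \<longleftrightarrow> b \<in> P)))"

lemma block_edge: "block e P \<Longrightarrow> e \<in> E"
  unfolding block_def by blast

lemma block_subset: "block e P \<Longrightarrow> P \<subseteq> e"
  unfolding block_def by blast

lemma block_red_iff:
  "block e P \<Longrightarrow> a \<in> e \<Longrightarrow> b \<in> e \<Longrightarrow> a \<noteq> b \<Longrightarrow> red (e - {a, b}) \<longleftrightarrow> (a \<in> P \<longleftrightarrow> b \<in> P)"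
  unfolding block_def by blast

lemma block_compl: "block e P \<Longrightarrow> block e (e - P)"
  unfolding block_def by auto

lemma block_of_vertex:
  assumes e: "e \<in> E" "w \<in> e"
  shows "block e {a \<in> e. a \<noteq> w \<and> \<not> red (e - {a, w})}"
  unfolding block_def
proof (intro conjI ballI impI)
  fix a b assume ab: "a \<in> e" "b \<in> e" "a \<noteq> b"
  show "red (e - {a, b}) \<longleftrightarrow>
    (a \<in> {a \<in> e. a \<noteq> w \<and> \<not> red (e - {a, w})} \<longleftrightarrow> b \<in> {a \<in> e. a \<noteq> w \<and> \<not> red (e - {a, w})})"
    using red_triple[of e a b w] e ab
    by (cases "a = w"; cases "b = w") (auto simp: insert_commute)
qed (use e in auto)

definition twins :: "'a set \<Rightarrow> 'a \<Rightarrow> 'a \<Rightarrow> 'a \<Rightarrow> bool" where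
  "twins Y q a b \<longleftrightarrow> a = b \<or> \<not> red (insert a (insert b (Y - {q})))"

lemma twins_refl: "twins Y q a a"
  unfolding twins_def by simp

lemma twins_commute: "twins Y q a b \<longleftrightarrow> twins Y q b a"
  unfolding twins_def by (auto simp: insert_commute)

lemma twins_star:
  assumes d: "d \<in> nbrs E (insert a (insert b (insert c (Y - {q}))))"
    and abc: "distinct [a, b, c]" "a \<notin> Y - {q}" "b \<notin> Y - {q}" "c \<notin> Y - {q}"
  shows "twins Y q a d \<longleftrightarrow> (twins Y q a b \<longleftrightarrow> \<not> twins Y q a c)"
proof -
  let ?W = "insert a (Y - {q})"
  have "insert b (insert c (insert d ?W)) \<in> E" "d \<notin> insert b (insert c ?W)"
    using d unfolding nbrs_def by (auto simp: insert_commute)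
  from red_insert[OF this(1)] this(2) abc
  have "red (insert d ?W) \<longleftrightarrow> (red (insert b ?W) \<longleftrightarrow> red (insert c ?W))" by auto
  thus ?thesis using \<open>d \<notin> insert b (insert c ?W)\<close> abc
    unfolding twins_def by (auto simp: insert_commute)
qed

text \<open>If \<open>Y\<close> is fully red, being twins is an equivalence relation on \<open>V - Y\<close> for each \<open>q \<in> Y\<close>.
  Without empty blocks any two vertices outside \<open>Y\<close> are twins for some \<open>q \<in> Y\<close>, although no class
  is all of \<open>V - Y\<close>. Hence two classes cross, and this produces three disjoint neighbourhoods of
  more than a third of the vertices each.\<close>

definition full_red :: "'a set \<Rightarrow> bool" where
  "full_red Y \<longleftrightarrow> Y \<subseteq> V \<and> card Y + 3 = r \<and> (\<forall>u\<in>V - Y. red (insert u Y))"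

lemma full_red_insert_two:
  assumes "full_red Y" "a \<in> V - Y" "b \<in> V - Y" "a \<noteq> b"
  shows "insert a (insert b Y) \<subseteq> V" "card (insert a (insert b Y)) = r - 1"
  using assms finite_subset[OF _ finite_V] unfolding full_red_def by auto

lemma full_red_exchange_three:
  assumes Y: "full_red Y" and "q \<in> Y" "distinct [a, b, c]"
    and "a \<in> V - (Y - {q})" "b \<in> V - (Y - {q})" "c \<in> V - (Y - {q})"
  shows "insert a (insert b (insert c (Y - {q}))) \<subseteq> V"
    "card (insert a (insert b (insert c (Y - {q})))) = r - 1"
proof -
  have "Y \<subseteq> V" "finite Y" "card Y + 3 = r"
    using Y finite_subset[OF _ finite_V] unfolding full_red_def by blast+
  moreover from this have "card (Y - {q}) + 4 = r" using card_Suc_Diff1[of Y q] \<open>q \<in> Y\<close> by simp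
  ultimately show "insert a (insert b (insert c (Y - {q}))) \<subseteq> V"
    "card (insert a (insert b (insert c (Y - {q})))) = r - 1"
    using assms(2-) by auto
qed

lemma twins_nbr:
  assumes Y: "full_red Y" and g: "g \<in> nbrs E (insert a (insert b Y))"
    and ab: "a \<in> V - Y" "b \<in> V - Y" "a \<noteq> b" and q: "q \<in> Y"
  shows "twins Y q a g \<longleftrightarrow> twins Y q a b"
proof -
  let ?W = "insert a (Y - {q})"
  have W: "insert q ?W = insert a Y" using q by auto
  hence "insert b (insert g (insert q ?W)) \<in> E" "g \<notin> insert b (insert a Y)"
    using g unfolding nbrs_def by (auto simp: insert_commute)
  from red_insert[OF this(1)] this(2) ab q
  have "red (insert q ?W) \<longleftrightarrow> (red (insert b ?W) \<longleftrightarrow> red (insert g ?W))" by auto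
  hence "red (insert b ?W) \<longleftrightarrow> red (insert g ?W)" using Y ab(1) W unfolding full_red_def by simp
  thus ?thesis using \<open>g \<notin> insert b (insert a Y)\<close> ab
    unfolding twins_def by (auto simp: insert_commute)
qed

lemma twins_trans:
  assumes Y: "full_red Y" and q: "q \<in> Y" and abf: "a \<in> V - Y" "b \<in> V - Y" "f \<in> V - Y"
    and twins: "twins Y q a b" "twins Y q b f"
  shows "twins Y q a f"
proof (rule ccontr)
  assume not: "\<not> twins Y q a f"
  hence distinct: "distinct [a, b, f]" using twins twins_refl by auto
  define N where "N c = nbrs E (insert a (insert b (insert c (Y - {q}))))" for c
  have N_star: "twins Y q a g \<longleftrightarrow> \<not> twins Y q a c" "twins Y q b g \<longleftrightarrow> \<not> twins Y q b c"
    if "g \<in> N c" "c \<in> V - (Y - {q})" "c \<noteq> a" "c \<noteq> b" for g c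
    using that twins_star[of g a b c Y q] twins_star[of g b a c Y q] distinct abf twins(1)
      twins_commute[of Y q a b] unfolding N_def by (auto simp: insert_commute)
  have sets: "insert a (insert b (insert c (Y - {q}))) \<subseteq> V"
    "card (insert a (insert b (insert c (Y - {q})))) = r - 1"
    if "c \<in> V - (Y - {q})" "c \<noteq> a" "c \<noteq> b" for c
    using full_red_exchange_three[OF Y q, of a b c] that abf distinct by auto
  have on_Nf: "twins Y q a g" "\<not> twins Y q b g" if "g \<in> N f" for g
    using N_star[OF that] abf distinct not twins(2) by auto
  obtain g where g: "g \<in> N f"
    using ex_nbr_neq[OF sets(1)[of f] sets(2)[of f]] abf distinct unfolding N_def by auto
  have g': "g \<in> V - (Y - {q})" "g \<noteq> a" "g \<noteq> b"
    using nbrs_mem[OF g[unfolded N_def]] by auto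
  have on_Ng: "\<not> twins Y q a h" "twins Y q b h" if "h \<in> N g" for h
    using N_star[OF that g'] on_Nf[OF g] by auto
  have on_Nq: "twins Y q a h" "twins Y q b h" if "h \<in> nbrs E (insert a (insert b Y))" for h
    using twins_nbr[OF Y, of h a b q] twins_nbr[OF Y, of h b a q] that abf distinct q twins(1)
      twins_commute[of Y q a b] by (auto simp: insert_commute)
  have "nbrs E (insert a (insert b Y)) \<inter> N f \<noteq> {} \<or> nbrs E (insert a (insert b Y)) \<inter> N g \<noteq> {} \<or>
      N f \<inter> N g \<noteq> {}"
    unfolding N_def
    by (rule nbrs_three_meet)
      (use sets[of f] sets[OF g'] full_red_insert_two[OF Y, of a b] abf distinct in auto)
  thus False using on_Nf on_Ng on_Nq by blast
qed

lemma twins_nbr_class: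
  assumes Y: "full_red Y" and "g \<in> nbrs E (insert u (insert w Y))" "u \<noteq> w" "q \<in> Y"
    and "u \<in> V - Y" "w \<in> V - Y" "p \<in> V - Y" and "twins Y q p u"
  shows "twins Y q p g \<longleftrightarrow> twins Y q p w"
proof -
  have same_class: "twins Y q p y \<longleftrightarrow> twins Y q u y" if "y \<in> V - Y" for y
    using twins_trans[OF Y, of q p u y] twins_trans[OF Y, of q u p y] assms(4,5,7,8) that
      twins_commute[of Y q p u] by blast
  have "g \<in> V - Y" using nbrs_mem[OF assms(2)] by blast
  moreover have "twins Y q u g \<longleftrightarrow> twins Y q u w" using assms by (intro twins_nbr)
  ultimately show ?thesis using same_class assms(6) by blast
qed

lemma ex_twins:
  assumes Y: "full_red Y" and no_empty_block: "\<And>e. \<not> block e {}"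
    and pu: "p \<in> V - Y" "u \<in> V - Y" "p \<noteq> u"
  shows "\<exists>q\<in>Y. twins Y q p u"
proof -
  obtain w where w: "w \<in> nbrs E (insert p (insert u Y))"
    using ex_nbr_neq[OF full_red_insert_two[OF Y pu]] by blast
  define e where "e = insert w (insert p (insert u Y))"
  have e: "e \<in> E" "w \<notin> insert p (insert u Y)" using w unfolding e_def nbrs_def by auto
  have "block e {a \<in> e. a \<noteq> w \<and> \<not> red (e - {a, w})}"
    using e(1) by (intro block_of_vertex) (auto simp: e_def)
  hence "{a \<in> e. a \<noteq> w \<and> \<not> red (e - {a, w})} \<noteq> {}" using no_empty_block[of e] by metis
  then obtain q where q: "q \<in> e" "q \<noteq> w" "\<not> red (e - {q, w})" by blast
  have "e - {p, w} = insert u Y" "e - {u, w} = insert p Y" using e(2) pu unfolding e_def by auto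
  hence "q \<noteq> p" "q \<noteq> u" using q(3) Y pu unfolding full_red_def by metis+
  hence "q \<in> Y" using q(1,2) unfolding e_def by blast
  moreover from this have "e - {q, w} = insert p (insert u (Y - {q}))"
    using e(2) pu unfolding e_def by auto
  ultimately show ?thesis using q(3) unfolding twins_def by auto
qed

lemma ex_not_twins:
  assumes Y: "full_red Y" and q: "q \<in> Y" and pv: "p \<in> V - Y" "v \<in> V - Y" "p \<noteq> v"
    and twins: "twins Y q p v"
  shows "\<exists>u\<in>V - Y. \<not> twins Y q p u"
proof -
  obtain w where w: "w \<in> nbrs E (insert p (insert v Y))"
    using ex_nbr_neq[OF full_red_insert_two[OF Y pv]] by blast
  hence w': "w \<in> V - Y" "w \<noteq> p" "w \<noteq> v" using nbrs_mem by blast+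
  obtain u where u: "u \<in> nbrs E (insert p (insert v (insert w (Y - {q}))))" "u \<noteq> q"
    using ex_nbr_neq[OF full_red_exchange_three[OF Y q, of p v w]] pv w' by auto
  hence "u \<in> V - Y" using nbrs_mem by blast
  moreover have "twins Y q p w" using twins_nbr[OF Y w pv q] twins by simp
  hence "\<not> twins Y q p u" using twins_star[OF u(1)] twins pv w' by auto
  ultimately show ?thesis by blast
qed

lemma twins_class_subset:
  assumes Y: "full_red Y" and qz: "q \<in> Y" "z \<in> Y" and p: "p \<in> V - Y"
    and x: "x \<in> V - Y" "x \<noteq> p" "twins Y q p x"
    and v: "v \<in> V - Y" "v \<noteq> p" "twins Y z p v"
    and u: "u \<in> V - Y" "\<not> twins Y z p u"
  shows "twins Y q p v"
proof (rule ccontr)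
  assume not_twins: "\<not> twins Y q p v"
  let ?N = "\<lambda>a b. nbrs E (insert a (insert b Y))"
  have px: "twins Y q p g" if "g \<in> ?N p x" for g
    using twins_nbr[OF Y that p x(1) _ qz(1)] x by auto
  have pv: "\<not> twins Y q p g" "twins Y z p g" if "g \<in> ?N p v" for g
    using twins_nbr[OF Y that p v(1) _ qz(1)] twins_nbr[OF Y that p v(1) _ qz(2)] v not_twins
    by auto
  have meet: "?N p x \<inter> ?N p v \<noteq> {} \<or> ?N p x \<inter> ?N v y \<noteq> {} \<or> ?N p v \<inter> ?N v y \<noteq> {}"
    if "y \<in> V - Y" "y \<noteq> v" for y
    by (rule nbrs_three_meet) (use full_red_insert_two[OF Y] p x v that in auto)
  show False
  proof (cases "\<exists>k\<in>?N p x. \<not> twins Y z p k")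
    case True
    then obtain k where k: "k \<in> ?N p x" "\<not> twins Y z p k" by blast
    have k': "k \<in> V - Y" "k \<noteq> v" using nbrs_mem[OF k(1)] k(2) v(3) by auto
    have "\<not> twins Y q p g \<and> \<not> twins Y z p g" if "g \<in> ?N v k" for g
      using that twins_nbr_class[OF Y, of g v k z p] twins_nbr_class[OF Y, of g k v q p]
        px[OF k(1)] k(2) k' v not_twins p qz by (auto simp: insert_commute)
    thus False using meet[OF k'] px pv by blast
  next
    case False
    have "u \<noteq> v" using u v by blast
    have "\<not> twins Y z p g" if "g \<in> ?N v u" for g
      using that twins_nbr_class[OF Y, of g v u z p] \<open>u \<noteq> v\<close> u v p qz by auto
    thus False using meet[OF u(1) \<open>u \<noteq> v\<close>] px pv False by blast
  qed
qed

lemma not_full_red: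
  assumes no_empty_block: "\<And>e. \<not> block e {}"
  shows "\<not> full_red Y"
proof
  assume Y: "full_red Y"
  note twins_exist = ex_twins[OF Y no_empty_block]
  have "Y \<subseteq> V" "card Y + 3 = r" using Y unfolding full_red_def by blast+
  hence "\<not> card (V - Y) \<le> Suc 0"
    using r_le_card finite_subset[OF _ finite_V] by (simp add: card_Diff_subset)
  then obtain p x where px: "p \<in> V - Y" "x \<in> V - Y" "p \<noteq> x"
    using card_le_Suc0_iff_eq[OF finite_Diff[OF finite_V]] by blast
  obtain q where q: "q \<in> Y" "twins Y q p x" using twins_exist[OF px] by blast
  obtain v where v: "v \<in> V - Y" "\<not> twins Y q p v" using ex_not_twins[OF Y q(1) px q(2)] by blast
  hence "p \<noteq> v" using twins_refl by blast
  obtain z where z: "z \<in> Y" "twins Y z p v" using twins_exist[OF px(1) v(1) \<open>p \<noteq> v\<close>] by blast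
  obtain u where u: "u \<in> V - Y" "\<not> twins Y z p u"
    using ex_not_twins[OF Y z(1) px(1) v(1) \<open>p \<noteq> v\<close> z(2)] by blast
  show False
    using twins_class_subset[OF Y q(1) z(1) px(1,2) _ q(2) v(1) _ z(2) u] px(3) \<open>p \<noteq> v\<close> v(2) by blast
qed

definition mates :: "'a set \<Rightarrow> 'a \<Rightarrow> 'a set" where
  "mates T u = {t \<in> T. red (insert u (T - {t}))}"

lemma mates_nbr:
  assumes "red T" "u \<notin> T" and w: "w \<in> nbrs E (insert u T)"
  shows "mates T w = mates T u"
proof -
  have "red (insert w (T - {t})) \<longleftrightarrow> red (insert u (T - {t}))" if t: "t \<in> T" for t
  proof -
    have T: "insert t (T - {t}) = T" using t by auto
    moreover have "insert t (insert u (insert w (T - {t}))) = insert w (insert u T)" using T by auto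
    ultimately have "insert t (insert u (insert w (T - {t}))) \<in> E" "w \<notin> insert u T"
      using w unfolding nbrs_def by auto
    from red_insert[OF this(1)] this(2) T show ?thesis using assms t by auto
  qed
  thus ?thesis unfolding mates_def by blast
qed

lemma mates_two_values:
  assumes T: "T \<subseteq> V" "card T + 2 = r" "red T" and u: "u \<in> V - T" "u' \<in> V - T" "u'' \<in> V - T"
  shows "mates T u = mates T u' \<or> mates T u = mates T u'' \<or> mates T u' = mates T u''"
proof -
  let ?N = "\<lambda>u. nbrs E (insert u T)"
  have "?N u \<inter> ?N u' \<noteq> {} \<or> ?N u \<inter> ?N u'' \<noteq> {} \<or> ?N u' \<inter> ?N u'' \<noteq> {}"
    by (rule nbrs_three_meet) (use T u finite_subset[OF T(1) finite_V] in auto)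
  moreover have "mates T v = mates T v'" if "?N v \<inter> ?N v' \<noteq> {}" "v \<in> V - T" "v' \<in> V - T" for v v'
    using mates_nbr[OF T(3), of v] mates_nbr[OF T(3), of v'] that by blast
  ultimately show ?thesis using u by blast
qed

lemma block_nonmates:
  assumes "red T" "u \<notin> T" and w: "w \<in> nbrs E (insert u T)"
  shows "block (insert w (insert u T)) (T - mates T u)"
proof -
  define e where "e = insert w (insert u T)"
  have e: "e \<in> E" "w \<notin> insert u T" using w unfolding e_def nbrs_def by auto
  have diff: "e - {u, w} = T" "\<And>t. t \<in> T \<Longrightarrow> e - {t, w} = insert u (T - {t})"
    using e(2) \<open>u \<notin> T\<close> unfolding e_def by auto
  have "{a \<in> e. a \<noteq> w \<and> \<not> red (e - {a, w})} = {t \<in> T. \<not> red (e - {t, w})}"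
  proof -
    have "a \<in> e \<longleftrightarrow> a = w \<or> a = u \<or> a \<in> T" for a unfolding e_def by blast
    thus ?thesis using diff(1) e(2) \<open>red T\<close> by auto
  qed
  also have "\<dots> = T - mates T u" unfolding mates_def using diff(2) by auto
  finally show ?thesis using block_of_vertex[OF e(1), of w] unfolding e_def by simp
qed

lemma mates_in_block:
  assumes P: "block e P" "x \<in> P" "x' \<in> P" "x \<noteq> x'"
  shows "mates (e - {x, x'}) x = P - {x, x'}"
proof -
  note subset = block_subset[OF P(1)]
  have "red (insert x (e - {x, x'} - {t})) \<longleftrightarrow> t \<in> P" if t: "t \<in> e - {x, x'}" for t
  proof -
    have "insert x (e - {x, x'} - {t}) = e - {t, x'}" using t P subset by auto
    thus ?thesis using block_red_iff[OF P(1), of t x'] t P subset by auto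
  qed
  thus ?thesis using subset unfolding mates_def by blast
qed

lemma ex_mates_other_block:
  assumes P: "block e P" "x \<in> P" "x' \<in> P" "x \<noteq> x'" and q: "q \<in> e - P"
  shows "\<exists>v\<in>V - (e - {x, x'}). q \<in> mates (e - {x, x'}) v"
proof -
  note subset = block_subset[OF P(1)]
  have "e - {q} \<subseteq> V" "card (e - {q}) = r - 1"
    using q edge_subset edge_card finite_edge block_edge[OF P(1)] by auto
  then obtain v where v: "v \<in> nbrs E (e - {q})" "v \<noteq> q" using ex_nbr_neq by blast
  define e' where "e' = insert v (e - {q})"
  have e': "e' \<in> E" "v \<notin> e" using v unfolding e'_def nbrs_def by auto
  have diff: "e' - {x, v} = e - {q, x}" "e' - {x', v} = e - {q, x'}"
    "e' - {x, x'} = insert v (e - {x, x'} - {q})"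
    using e'(2) q P subset unfolding e'_def by auto
  have "\<not> red (e - {q, x})" "\<not> red (e - {q, x'})"
    using block_red_iff[OF P(1), of q] q P subset by auto
  hence "red (e' - {x, x'})"
    using red_triple[OF e'(1), of x x' v] diff e'(2) P q subset unfolding e'_def by auto
  hence "q \<in> mates (e - {x, x'}) v" using diff(3) q P unfolding mates_def by auto
  moreover have "v \<in> V" using v nbrs_subset by blast
  ultimately show ?thesis using e'(2) by blast
qed

lemma block_descent:
  assumes no_empty_block: "\<And>e. \<not> block e {}"
    and P: "block e P" "x \<in> P" "x' \<in> P" "x \<noteq> x'"
  shows "\<exists>e'. block e' (P - {x, x'})"
proof -
  note edge = block_edge[OF P(1)] and subset = block_subset[OF P(1)]
  have ends: "x \<in> e" "x' \<in> e" using subset P by auto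
  define T where "T = e - {x, x'}"
  have T: "T \<subseteq> V" "card T + 2 = r" "red T"
    using edge_subset edge_card[of e] finite_edge[of e] edge ends P(2-4) three_le_r
      block_red_iff[OF P(1), of x x'] unfolding T_def by (auto simp: card_Diff_subset)
  have x_mates: "mates T x = P - {x, x'}" unfolding T_def by (rule mates_in_block[OF P])
  have "e - P \<noteq> {}" using no_empty_block block_compl[OF P(1)] by metis
  then obtain q v where v: "q \<in> e - P" "v \<in> V - T" "q \<in> mates T v"
    using ex_mates_other_block[OF P] unfolding T_def by blast
  have two_values: "mates T u = mates T x \<or> mates T u = mates T v" if "u \<in> V - T" for u
    using mates_two_values[OF T, of x v u] that v x_mates edge_subset[OF edge] subset P
    by (auto simp: T_def)
  have "mates T v = e - P"
  proof
    show "e - P \<subseteq> mates T v"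
      using ex_mates_other_block[OF P] two_values x_mates unfolding T_def by blast
    show "mates T v \<subseteq> e - P"
    proof (rule ccontr)
      assume "\<not> mates T v \<subseteq> e - P"
      then obtain p where p: "p \<in> T" "p \<in> mates T v" "p \<in> mates T x"
        using x_mates unfolding mates_def T_def by blast
      hence "p \<in> mates T u" if "u \<in> V - T" for u using two_values[OF that] by blast
      hence "red (insert u (T - {p}))" if "u \<in> V - (T - {p})" for u
        using that T(3) p(1) by (cases "u = p") (auto simp: mates_def insert_absorb)
      moreover have "card (T - {p}) + 3 = r" "T - {p} \<subseteq> V"
        using T p(1) finite_subset[OF T(1) finite_V] card_Suc_Diff1[of T p] by auto
      ultimately show False using not_full_red[OF no_empty_block] unfolding full_red_def by blast
    qed
  qed
  moreover have "insert v T \<subseteq> V" "card (insert v T) = r - 1"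
    using T v finite_subset[OF T(1) finite_V] by auto
  then obtain w where "w \<in> nbrs E (insert v T)" using ex_nbr_neq by blast
  hence "block (insert w (insert v T)) (T - mates T v)" using T v by (intro block_nonmates) auto
  moreover have "T - (e - P) = P - {x, x'}" using subset unfolding T_def by blast
  ultimately show ?thesis by auto
qed

lemma block_card_odd_less:
  assumes "odd d" and indivisible: "\<And>e P. block e P \<Longrightarrow> \<not> d dvd card P" and "block e P"
  shows "odd (card P) \<and> card P < d"
  using \<open>block e P\<close>
proof (induction "card P" arbitrary: e P rule: less_induct)
  case less
  show ?case
  proof (cases "card P \<le> 1")
    case True
    moreover have "card P \<noteq> 0" using indivisible[OF less.prems] by (metis dvd_0_right)
    ultimately have "card P = 1" by simp
    thus ?thesis using indivisible[OF less.prems] \<open>odd d\<close> by (cases d) auto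
  next
    case False
    then obtain x x' where x: "x \<in> P" "x' \<in> P" "x \<noteq> x'"
      by (metis One_nat_def card_eq_0_iff card_le_Suc0_iff_eq le_0_eq nat_le_linear)
    have "\<not> block e {}" for e using indivisible[of e "{}"] by auto
    then obtain e' where e': "block e' (P - {x, x'})" using block_descent[OF _ less.prems x] by blast
    have "card (P - {x, x'}) + 2 = card P" using False x by (simp add: card_Diff_subset)
    hence "odd (card P)" "card P < d + 2" using less.hyps[OF _ e'] by presburger+
    moreover have "card P \<noteq> d" using indivisible[OF less.prems] by auto
    ultimately show ?thesis using \<open>odd d\<close> by presburger
  qed
qed

lemma ex_block_card_dvd:
  assumes d: "odd d" "d dvd r"
  shows "\<exists>e P. block e P \<and> d dvd card P"
proof (rule ccontr)
  assume "\<not> ?thesis"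
  hence sizes: "odd (card P) \<and> card P < d" if "block e P" for e P
    using block_card_odd_less[OF d(1) _ that] by blast
  obtain e where edge: "e \<in> E" using ex_edge[OF r_le_card] by blast
  hence "e \<noteq> {}" using edge_card[of e] three_le_r by auto
  then obtain P where P: "block e P" using block_of_vertex[OF edge] by blast
  note subset = block_subset[OF P]
  have "finite P" using finite_edge[OF edge] subset by (rule finite_subset[rotated])
  hence card: "card P + card (e - P) = r"
    using edge_card[OF edge] subset card_mono[OF finite_edge[OF edge] subset]
    by (simp add: card_Diff_subset)
  have odd: "odd (card P)" "odd (card (e - P))" and less: "card P < d" "card (e - P) < d"
    using sizes[OF P] sizes[OF block_compl[OF P]] by auto
  obtain c where c: "r = d * c" using d(2) by blast
  have "even r" using odd card by presburger
  hence "even c" using c d(1) by simp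
  moreover have "c \<noteq> 0" using c three_le_r by (cases "c = 0") auto
  ultimately have "c \<ge> 2" by presburger
  hence "2 * d \<le> r" using c by simp
  thus False using less card by linarith
qed

end

subsection \<open>Dense hypergraphs are not free\<close>

context codegree_gt_third
begin

lemma transposes_reachable_if_not_transitive:
  assumes abc: "e \<in> E" "a \<in> e" "b \<in> e" "c \<in> e" "distinct [a, b, c]"
    and links: "\<not> bipartite (link E (e - {a, b}))" "\<not> bipartite (link E (e - {b, c}))"
      "bipartite (link E (e - {a, c}))"
    and xy: "x \<in> e" "y \<in> e"
  shows "transpose x y \<in> reachable_perms E e"
proof -
  interpret perm_monoid "reachable_perms E e" by (rule perm_monoid_reachable_perms)
  have ab: "transpose a b \<in> reachable_perms E e" and bc: "transpose b c \<in> reachable_perms E e"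
    using transpose_reachable abc links by auto
  have "transpose a y \<in> reachable_perms E e" if y: "y \<in> e" for y
  proof -
    consider (first) "y = a" | (last) "y = c"
      | (near_first) "y \<noteq> a" "\<not> bipartite (link E (e - {a, y}))"
      | (near_last) "y \<noteq> c" "\<not> bipartite (link E (e - {c, y}))"
      using one_of_three_links_not_bipartite[of e a c y] abc links(3) y by auto
    thus ?thesis
    proof cases
      case first
      thus ?thesis using id_mem by simp
    next
      case last
      thus ?thesis using transpose_mem_trans[OF ab bc] by simp
    next
      case near_first
      thus ?thesis using transpose_reachable abc y by auto
    next
      case near_last
      hence "transpose c y \<in> reachable_perms E e" using transpose_reachable abc y by auto
      thus ?thesis by (rule transpose_mem_trans[OF transpose_mem_trans[OF ab bc]])
    qed
  qed
  thus ?thesis using transpose_mem_trans[of x a y] xy by (metis transpose_commute)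
qed

lemma two_block_colouring_links:
  assumes "3 \<le> r" "r \<le> card V"
    and unreachable: "\<And>e. e \<in> E \<Longrightarrow> \<exists>x\<in>e. \<exists>y\<in>e. transpose x y \<notin> reachable_perms E e"
  shows "two_block_colouring V E r (\<lambda>T. \<not> bipartite (link E T))"
proof
  fix e a b c
  assume abc: "e \<in> E" "a \<in> e" "b \<in> e" "c \<in> e" "distinct [a, b, c]"
  have trans: "\<not> bipartite (link E (e - {x, z}))"
    if "{x, y, z} = {a, b, c}" "\<not> bipartite (link E (e - {x, y}))"
      "\<not> bipartite (link E (e - {y, z}))"
    for x y z
  proof -
    have "card {x, y, z} = 3" using that(1) abc(5) by simp
    hence "distinct [x, y, z]" by (auto simp: card_insert_if split: if_splits)
    moreover have "{x, y, z} \<subseteq> e" using that(1) abc by simp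
    ultimately show ?thesis
      using transposes_reachable_if_not_transitive[of e x y z] abc(1) that(2,3)
        unreachable[OF abc(1)] by auto
  qed
  let ?red = "\<lambda>a b. \<not> bipartite (link E (e - {a, b}))"
  have "?red a b \<Longrightarrow> ?red b c \<Longrightarrow> ?red a c" "?red a c \<Longrightarrow> ?red b c \<Longrightarrow> ?red a b"
    "?red a b \<Longrightarrow> ?red a c \<Longrightarrow> ?red b c"
    using trans[of a b c] trans[of a c b] trans[of b a c] by (simp_all add: insert_commute)
  thus "?red a b \<longleftrightarrow> (?red a c \<longleftrightarrow> ?red b c)"
    using one_of_three_links_not_bipartite[OF abc] by blast
qed (use assms in auto)

lemma ex_reachable_block:
  assumes r: "3 \<le> r" "r \<le> card V" and d: "odd d" "d dvd r"
  shows "\<exists>e\<in>E. \<exists>P\<subseteq>e. d dvd card P \<and>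
    (\<forall>a\<in>e. \<forall>b\<in>e. (a \<in> P \<longleftrightarrow> b \<in> P) \<longrightarrow> transpose a b \<in> reachable_perms E e)"
proof (cases "\<exists>e\<in>E. \<forall>a\<in>e. \<forall>b\<in>e. transpose a b \<in> reachable_perms E e")
  case True
  then obtain e where "e \<in> E" "\<forall>a\<in>e. \<forall>b\<in>e. transpose a b \<in> reachable_perms E e" by blast
  thus ?thesis by (intro bexI[of _ e] exI[of _ "{}"]) auto
next
  case False
  hence colouring: "two_block_colouring V E r (\<lambda>T. \<not> bipartite (link E T))"
    by (intro two_block_colouring_links r) blast
  let ?block = "two_block_colouring.block E (\<lambda>T. \<not> bipartite (link E T))"
  obtain e P where block: "?block e P" and dvd: "d dvd card P"
    using two_block_colouring.ex_block_card_dvd[OF colouring d] by blast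
  hence e: "e \<in> E" "P \<subseteq> e"
    using two_block_colouring.block_edge[OF colouring] two_block_colouring.block_subset[OF colouring]
    by blast+
  have "transpose a b \<in> reachable_perms E e" if ab: "a \<in> e" "b \<in> e" "a \<in> P \<longleftrightarrow> b \<in> P" for a b
  proof (cases "a = b")
    case True
    thus ?thesis using perm_monoid.id_mem[OF perm_monoid_reachable_perms] by simp
  next
    case False
    thus ?thesis
      using transpose_reachable[OF e(1) ab(1,2) False] ab
        two_block_colouring.block_red_iff[OF colouring block ab(1,2) False] by blast
  qed
  thus ?thesis using e dvd by blast
qed

lemma transpose_reachable_if_codegree_gt_half:
  assumes e: "e \<in> E" "a \<in> e" "b \<in> e"
    and half: "\<And>c. c \<in> e \<Longrightarrow> card V < 2 * card (nbrs E (e - {c}))"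
  shows "transpose a b \<in> reachable_perms E e"
proof (cases "a = b")
  case True
  thus ?thesis using perm_monoid.id_mem[OF perm_monoid_reachable_perms] by simp
next
  case False
  have "\<not> disjoint_family_on (\<lambda>c. nbrs E (e - {c})) {a, b}"
    using finite_V nbrs_subset half[OF e(2)] half[OF e(3)] False
    by (intro not_disjoint_family_on_if_large) auto
  then obtain c where "c \<in> nbrs E (e - {a})" "c \<in> nbrs E (e - {b})"
    using False unfolding disjoint_family_on_def by blast
  thus ?thesis using not_bipartite_link_of_common_nbr transpose_reachable e False by blast
qed

end

lemma card_edges_containing:
  assumes H: "r_graph r H" "r > 0" and S: "S \<subseteq> verts H" "card S = r - 1"
  shows "card {e \<in> edges H. S \<subseteq> e} = card (nbrs (edges H) S)"
proof -
  have "finite S" using S H finite_subset unfolding r_graph_def by blast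
  have "{e \<in> edges H. S \<subseteq> e} = (\<lambda>v. insert v S) ` nbrs (edges H) S"
  proof (intro equalityI subsetI)
    fix e assume e: "e \<in> {e \<in> edges H. S \<subseteq> e}"
    hence "card (e - S) = 1"
      using H S \<open>finite S\<close> unfolding r_graph_def by (auto simp: card_Diff_subset)
    then obtain v where "e - S = {v}" by (metis card_1_singletonE)
    hence "v \<notin> S" "e = insert v S" using e by auto
    thus "e \<in> (\<lambda>v. insert v S) ` nbrs (edges H) S" using e unfolding nbrs_def by auto
  qed (auto simp: nbrs_def)
  moreover have "inj_on (\<lambda>v. insert v S) (nbrs (edges H) S)"
    by (rule inj_onI) (auto simp: nbrs_def)
  ultimately show ?thesis by (simp add: card_image)
qed

lemma min_codegree_eq_Min_nbrs:
  assumes "r_graph r H" "r > 0"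
  shows "min_codegree r H =
    Min ((\<lambda>S. card (nbrs (edges H) S)) ` {S. S \<subseteq> verts H \<and> card S = r - 1})"
  unfolding min_codegree_def setcompr_eq_image
  by (intro arg_cong[of _ _ Min] image_cong refl) (use card_edges_containing[OF assms] in blast)

lemma min_codegree_le:
  assumes "r_graph r H" "r > 0" "S \<subseteq> verts H" "card S = r - 1"
  shows "min_codegree r H \<le> card (nbrs (edges H) S)"
  unfolding min_codegree_eq_Min_nbrs[OF assms(1,2)]
  by (rule Min_le) (use assms in \<open>auto simp: r_graph_def\<close>)

lemma min_codegree_ge:
  assumes H: "r_graph r H" "r > 0" "r \<le> card (verts H)"
    and "\<And>S. S \<subseteq> verts H \<Longrightarrow> card S = r - 1 \<Longrightarrow> m \<le> card (nbrs (edges H) S)"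
  shows "m \<le> min_codegree r H"
proof -
  show ?thesis
    unfolding min_codegree_eq_Min_nbrs[OF H(1,2)] using ex_subset_card_diff_one[OF H(3)]
    by (intro Min.boundedI) (use assms in \<open>auto simp: r_graph_def\<close>)
qed

lemma min_codegree_le_card:
  assumes H: "r_graph r H" "r > 0" "r \<le> card (verts H)"
  shows "min_codegree r H \<le> card (verts H)"
proof -
  obtain S where S: "S \<subseteq> verts H" "card S = r - 1"
    using ex_subset_card_diff_one[OF H(3)] by blast
  have "nbrs (edges H) S \<subseteq> verts H" "finite (verts H)"
    using H(1) unfolding nbrs_def r_graph_def by blast+
  thus ?thesis using min_codegree_le[OF H(1,2) S] card_mono le_trans by blast
qed

lemma codegree_gt_third_if_min_codegree:
  assumes H: "r_graph r H" "r > 0" and dense: "card (verts H) < 3 * min_codegree r H"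
  shows "codegree_gt_third (verts H) (edges H) r"
proof
  fix S assume "S \<subseteq> verts H" "card S = r - 1"
  thus "card (verts H) < 3 * card (nbrs (edges H) S)"
    using min_codegree_le[OF H, of S] dense by simp
qed (use H in \<open>auto simp: r_graph_def\<close>)

lemma not_free_if_min_codegree_gt_third:
  fixes H :: "nat hypergraph"
  assumes H: "r_graph r H" and r: "3 \<le> r" "r \<le> card (verts H)"
    and odd: "odd (r div gcd r k)" and dense: "card (verts H) < 3 * min_codegree r H"
  shows "\<not> family_free (cycle_hom_family r k) H"
proof -
  interpret codegree_gt_third "verts H" "edges H" r
    using H r dense by (intro codegree_gt_third_if_min_codegree) auto
  have "r div gcd r k dvd r" using dvd_triv_left[of "r div gcd r k" "gcd r k"] by simp
  then obtain e P where "e \<in> edges H" "P \<subseteq> e" "r div gcd r k dvd card P"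
    and "\<forall>a\<in>e. \<forall>b\<in>e. (a \<in> P \<longleftrightarrow> b \<in> P) \<longrightarrow> transpose a b \<in> reachable_perms (edges H) e"
    using ex_reachable_block[OF r odd] by blast
  thus ?thesis using r by (intro not_free_of_reachable_block[OF H, of e P]) auto
qed

lemma not_free_if_min_codegree_gt_half:
  fixes H :: "nat hypergraph"
  assumes H: "r_graph r H" and r: "r > 0" "r \<le> card (verts H)"
    and dense: "card (verts H) < 2 * min_codegree r H"
  shows "\<not> family_free (cycle_hom_family r k) H"
proof -
  interpret codegree_gt_third "verts H" "edges H" r
    using H r dense by (intro codegree_gt_third_if_min_codegree) auto
  obtain e where e: "e \<in> edges H" using ex_edge[OF r(2)] by blast
  have "card (verts H) < 2 * card (nbrs (edges H) (e - {c}))" if "c \<in> e" for c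
  proof -
    have "e - {c} \<subseteq> verts H" "card (e - {c}) = r - 1"
      using edge_subset[OF e] edge_card[OF e] finite_edge[OF e] that by auto
    from min_codegree_le[OF H r(1) this] show ?thesis using dense by linarith
  qed
  hence "transpose a b \<in> reachable_perms (edges H) e" if "a \<in> e" "b \<in> e" for a b
    using transpose_reachable_if_codegree_gt_half[OF e that] by blast
  thus ?thesis by (intro not_free_of_reachable_block[OF H r(1) e, of "{}"]) auto
qed

subsection \<open>Extremal codegrees and the parity construction\<close>

lemma finite_min_codegrees:
  assumes "r > 0" "r \<le> n"
  shows "finite {min_codegree r H | H :: nat hypergraph.
    r_graph r H \<and> card (verts H) = n \<and> family_free \<F> H}"
  by (rule finite_subset[of _ "{..n}"]) (use assms min_codegree_le_card in auto)

lemma min_codegree_le_codegree_ex: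
  fixes H :: "nat hypergraph"
  assumes "r > 0" "r \<le> n" "r_graph r H" "card (verts H) = n" "family_free \<F> H"
  shows "min_codegree r H \<le> codegree_ex r n \<F>"
  unfolding codegree_ex_def using assms by (intro Max_ge finite_min_codegrees) auto

lemma codegree_ex_attained:
  assumes "r > 0" "r \<le> n" and nonempty: "\<And>F. F \<in> \<F> \<Longrightarrow> edges F \<noteq> {}"
  shows "\<exists>H :: nat hypergraph. r_graph r H \<and> card (verts H) = n \<and> family_free \<F> H \<and>
    min_codegree r H = codegree_ex r n \<F>"
proof -
  define H0 :: "nat hypergraph" where "H0 = \<lparr>verts = {..<n}, edges = {}\<rparr>"
  have "r_graph r H0" "card (verts H0) = n" "family_free \<F> H0"
    using nonempty
    by (auto simp: H0_def r_graph_def family_free_def contains_copy_def hypergraph_hom_def)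
  hence "{min_codegree r H | H :: nat hypergraph.
      r_graph r H \<and> card (verts H) = n \<and> family_free \<F> H} \<noteq> {}"
    by blast
  from Max_in[OF finite_min_codegrees[OF assms(1,2)] this] show ?thesis
    unfolding codegree_ex_def by auto
qed

lemma mult_codegree_ex_le:
  assumes "r > 0" "r \<le> n" "\<And>F. F \<in> \<F> \<Longrightarrow> edges F \<noteq> {}"
    and not_free: "\<And>H :: nat hypergraph. r_graph r H \<Longrightarrow> card (verts H) = n \<Longrightarrow>
      n < c * min_codegree r H \<Longrightarrow> \<not> family_free \<F> H"
  shows "c * codegree_ex r n \<F> \<le> n"
  using codegree_ex_attained[OF assms(1-3)] not_free by (metis not_le)

lemma codegree_ex_le:
  assumes "r > 0" "r \<le> n" "\<And>F. F \<in> \<F> \<Longrightarrow> edges F \<noteq> {}"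
  shows "codegree_ex r n \<F> \<le> n"
  using codegree_ex_attained[OF assms] min_codegree_le_card assms by metis

lemma edges_nonempty_cycle_hom_family:
  assumes "F \<in> cycle_hom_family r k"
  shows "edges F \<noteq> {}"
  using assms unfolding hom_family_def tight_cycle_family_def tight_cycle_def by fastforce

lemma family_free_if_odd_intersections:
  fixes H :: "nat hypergraph"
  assumes H: "r_graph r H" "r > 0" and even: "even (r div gcd r k)"
    and odd: "\<And>e. e \<in> edges H \<Longrightarrow> odd (card (e \<inter> A))"
  shows "family_free (cycle_hom_family r k) H"
  unfolding family_free_iff_no_closed_tight_walk[OF H]
proof (intro allI impI notI)
  fix l x assume l: "r < l" "[l = k] (mod r)" and walk: "closed_tight_walk r (edges H) l x"
  define f :: "nat \<Rightarrow> nat" where "f i = of_bool (x i \<in> A)" for i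
  have window: "odd (\<Sum>j=i..<i + r. f j)" for i
  proof -
    have edge: "x ` {i..<i + r} \<in> edges H" using walk unfolding closed_tight_walk_def by blast
    hence inj: "inj_on x {i..<i + r}"
      using H(1) unfolding r_graph_def by (intro eq_card_imp_inj_on) auto
    have "(\<Sum>j=i..<i + r. f j) = card {j \<in> {i..<i + r}. x j \<in> A}"
      unfolding f_def by (simp add: sum.If_cases of_bool_def Int_def)
    also have "\<dots> = card (x ` {j \<in> {i..<i + r}. x j \<in> A})"
      by (rule card_image[symmetric]) (rule inj_on_subset[OF inj], blast)
    also have "x ` {j \<in> {i..<i + r}. x j \<in> A} = x ` {i..<i + r} \<inter> A" by blast
    finally show ?thesis using odd[OF edge] by simp
  qed
  have "f (i + r) = f i" for i
  proof -
    have "(\<Sum>j=i..<i + r. f j) + f (i + r) = f i + (\<Sum>j=Suc i..<Suc i + r. f j)"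
      using \<open>r > 0\<close> by (simp add: sum.atLeast_Suc_lessThan[of i "i + r"])
    hence "even (f (i + r)) \<longleftrightarrow> even (f i)" using window[of i] window[of "Suc i"]
      by (metis even_add)
    thus ?thesis unfolding f_def by (simp split: if_splits add: of_bool_def)
  qed
  moreover have "f (i + l) = f i" for i using walk unfolding f_def closed_tight_walk_def by simp
  ultimately have "r div gcd r l dvd (\<Sum>j<r. f j)" by (rule dvd_sum_two_periods)
  moreover have "gcd r l = gcd r k" using cong_gcd_eq[OF l(2)] by (simp add: gcd.commute)
  ultimately have "even (\<Sum>j<r. f j)" using even by (metis dvd_trans)
  thus False using window[of 0] by (simp add: lessThan_atLeast0)
qed

definition parity_hypergraph :: "nat \<Rightarrow> 'a set \<Rightarrow> 'a set \<Rightarrow> 'a hypergraph" where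
  "parity_hypergraph r V A = \<lparr>verts = V, edges = {e. e \<subseteq> V \<and> card e = r \<and> odd (card (e \<inter> A))}\<rparr>"

lemma min_codegree_parity_hypergraph:
  assumes V: "finite V" "r \<le> card V" "r > 0" and A: "A \<subseteq> V" "m \<le> card A" "m \<le> card (V - A)"
  shows "m - r \<le> min_codegree r (parity_hypergraph r V A)"
proof (rule min_codegree_ge)
  let ?H = "parity_hypergraph r V A"
  fix S assume "S \<subseteq> verts ?H" and card_S: "card S = r - 1"
  hence S: "S \<subseteq> V" "finite S" using V finite_subset unfolding parity_hypergraph_def by auto
  define B where "B = (if even (card (S \<inter> A)) then A else V - A)"
  have "B \<subseteq> V" "m \<le> card B" using A unfolding B_def by auto
  have "odd (card (insert v S \<inter> A))" if "v \<in> B - S" for v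
    using that S unfolding B_def by (auto simp: Int_insert_left split: if_splits)
  hence "B - S \<subseteq> nbrs (edges ?H) S"
    using S \<open>B \<subseteq> V\<close> card_S V(3) unfolding nbrs_def parity_hypergraph_def by auto
  moreover have "nbrs (edges ?H) S \<subseteq> V" unfolding nbrs_def parity_hypergraph_def by auto
  ultimately have "card (B - S) \<le> card (nbrs (edges ?H) S)"
    using V(1) by (meson card_mono finite_subset)
  moreover have "card B - card S \<le> card (B - S)" using S(2) by (rule diff_card_le_card_Diff)
  ultimately show "m - r \<le> card (nbrs (edges ?H) S)" using \<open>m \<le> card B\<close> card_S by linarith
qed (use V in \<open>auto simp: r_graph_def parity_hypergraph_def\<close>)

lemma codegree_ex_ge_half:
  assumes "r > 0" "r \<le> n" and even: "even (r div gcd r k)"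
  shows "n div 2 - r \<le> codegree_ex r n (cycle_hom_family r k)"
proof -
  let ?H = "parity_hypergraph r {..<n} {..<n div 2}"
  have H: "r_graph r ?H" "card (verts ?H) = n" unfolding r_graph_def parity_hypergraph_def by auto
  have "family_free (cycle_hom_family r k) ?H"
    by (rule family_free_if_odd_intersections[OF H(1) \<open>r > 0\<close> even, of "{..<n div 2}"])
      (simp add: parity_hypergraph_def)
  hence "min_codegree r ?H \<le> codegree_ex r n (cycle_hom_family r k)"
    using assms H by (intro min_codegree_le_codegree_ex)
  moreover have "n div 2 - r \<le> min_codegree r ?H"
    using assms by (intro min_codegree_parity_hypergraph) (auto simp: card_Diff_subset)
  ultimately show ?thesis by linarith
qed

subsection \<open>Random samples almost preserve densities\<close>

lemma prob_bind_pmf_le: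
  assumes "\<And>x. x \<in> set_pmf M \<Longrightarrow> measure_pmf.prob (N x) A \<le> c" "0 \<le> c"
  shows "measure_pmf.prob (bind_pmf M N) A \<le> c"
proof -
  have "emeasure (bind_pmf M N) A = (\<integral>\<^sup>+x. emeasure (N x) A \<partial>M)" by simp
  also have "\<dots> \<le> (\<integral>\<^sup>+x. ennreal c \<partial>M)"
    using assms(1)
    by (intro nn_integral_mono_AE)
      (auto simp: AE_measure_pmf_iff measure_pmf.emeasure_eq_measure intro: ennreal_leI)
  also have "\<dots> = ennreal c" by simp
  finally show ?thesis using \<open>0 \<le> c\<close> by (simp add: measure_pmf.emeasure_eq_measure)
qed

lemma ex_set_pmf_notin:
  assumes "measure_pmf.prob D A < 1"
  shows "\<exists>x\<in>set_pmf D. x \<notin> A"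
proof (rule ccontr)
  assume "\<not> ?thesis"
  hence "AE x in D. x \<in> A" by (auto simp: AE_measure_pmf_iff)
  hence "measure_pmf.prob D A = 1" by (simp add: measure_pmf.prob_eq_1)
  thus False using assms by simp
qed

lemma prob_Pi_pmf_le:
  assumes I: "finite I" "S \<subseteq> I" and "0 \<le> c"
    and le: "\<And>g. g \<in> set_pmf (Pi_pmf S d p) \<Longrightarrow>
      measure_pmf.prob (Pi_pmf (I - S) d p) {h. (\<lambda>i. if i \<in> S then g i else h i) \<in> X} \<le> c"
  shows "measure_pmf.prob (Pi_pmf I d p) X \<le> c"
proof -
  have "Pi_pmf I d p = map_pmf (\<lambda>(g, h) i. if i \<in> S then g i else h i)
      (pair_pmf (Pi_pmf S d p) (Pi_pmf (I - S) d p))"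
    using Pi_pmf_union[OF finite_subset[OF I(2,1)], of "I - S" d p] I by (simp add: Un_absorb1)
  also have "\<dots> = bind_pmf (Pi_pmf S d p)
      (\<lambda>g. map_pmf (\<lambda>h i. if i \<in> S then g i else h i) (Pi_pmf (I - S) d p))"
    unfolding pair_pmf_def map_bind_pmf map_pmf_def[symmetric]
    by (simp add: map_pmf_def bind_assoc_pmf bind_return_pmf)
  finally show ?thesis
    using le \<open>0 \<le> c\<close> by (simp add: prob_bind_pmf_le vimage_def)
qed

lemma map_pmf_of_set_bernoulli:
  assumes "finite V" "V \<noteq> {}" "W \<subseteq> V"
  shows "map_pmf (\<lambda>v. v \<in> W) (pmf_of_set V) = bernoulli_pmf (card W / card V)"
proof (rule pmf_eqI)
  fix b
  have "card W \<le> card V" "card V > 0" using assms card_mono by (auto simp: card_gt_0_iff)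
  moreover have "V \<inter> (\<lambda>v. v \<in> W) -` {True} = W" "V \<inter> (\<lambda>v. v \<in> W) -` {False} = V - W"
    using assms(3) by auto
  ultimately show "pmf (map_pmf (\<lambda>v. v \<in> W) (pmf_of_set V)) b =
      pmf (bernoulli_pmf (card W / card V)) b"
    using assms finite_subset[OF assms(3,1)]
    by (cases b) (simp_all add: pmf_map measure_pmf_of_set card_Diff_subset of_nat_diff
        diff_divide_distrib)
qed

lemma prob_few_hits_le:
  fixes p \<epsilon> :: real
  assumes B: "finite B" and V: "finite V" "V \<noteq> {}" and W: "W \<subseteq> V" "p * card V \<le> card W"
    and "0 \<le> \<epsilon>"
  shows "measure_pmf.prob (Pi_pmf B d (\<lambda>_. pmf_of_set V))
      {h. card {j \<in> B. h j \<in> W} \<le> (p - \<epsilon>) * card B}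
    \<le> exp (- 2 * \<epsilon>\<^sup>2 * card B)"
proof (cases "B = {}")
  case True
  thus ?thesis by simp
next
  case False
  hence "card B > 0" using B by (simp add: card_gt_0_iff)
  define q where "q = card W / card V"
  have "card V > 0" "card W \<le> card V" using V W card_mono by (auto simp: card_gt_0_iff)
  hence q: "q \<in> {0..1}" "p \<le> q" using W(2) unfolding q_def by (auto simp: field_simps)
  have "map_pmf (\<lambda>h. card {j \<in> B. h j \<in> W}) (Pi_pmf B d (\<lambda>_. pmf_of_set V)) =
      map_pmf (\<lambda>h. card {j \<in> B. h j}) (Pi_pmf B (d \<in> W) (\<lambda>_. bernoulli_pmf q))"
    unfolding q_def map_pmf_of_set_bernoulli[OF V W(1), symmetric]
    by (simp add: Pi_pmf_map[OF B, of _ d] pmf.map_comp o_def)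
  also have "\<dots> = binomial_pmf (card B) q"
    using binomial_pmf_altdef'[OF B refl q(1)] by simp
  finally have binomial: "map_pmf (\<lambda>h. card {j \<in> B. h j \<in> W}) (Pi_pmf B d (\<lambda>_. pmf_of_set V)) =
      binomial_pmf (card B) q" .
  have "measure_pmf.prob (Pi_pmf B d (\<lambda>_. pmf_of_set V))
      {h. card {j \<in> B. h j \<in> W} \<le> (p - \<epsilon>) * card B}
      = measure_pmf.prob (binomial_pmf (card B) q) {x. x \<le> (p - \<epsilon>) * card B}"
    unfolding binomial[symmetric] by (simp add: vimage_def)
  also have "\<dots> \<le> measure_pmf.prob (binomial_pmf (card B) q) {x. x \<le> card B * q - \<epsilon> * card B}"
  proof (rule measure_pmf.finite_measure_mono)
    have "(p - \<epsilon>) * card B \<le> card B * q - \<epsilon> * card B"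
      using mult_right_mono[OF q(2), of "card B"] by (simp add: algebra_simps)
    thus "{x. real x \<le> (p - \<epsilon>) * card B} \<subseteq> {x. real x \<le> card B * q - \<epsilon> * card B}" by auto
  qed simp
  also have "\<dots> \<le> exp (- 2 * (\<epsilon> * card B)\<^sup>2 / card B)"
    using q(1) \<open>card B > 0\<close> \<open>0 \<le> \<epsilon>\<close>
    by (intro binomial_distribution.prob_le) (auto simp: binomial_distribution_def)
  also have "\<dots> = exp (- 2 * \<epsilon>\<^sup>2 * card B)"
    using \<open>card B > 0\<close> by (simp add: power2_eq_square)
  finally show ?thesis .
qed

lemma prob_sparse_sample_le:
  fixes p \<epsilon> :: real
  assumes I: "finite I" "S \<subseteq> I" and V: "finite V" "V \<noteq> {}" and "0 \<le> \<epsilon>"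
    and N: "\<And>T. T \<subseteq> V \<Longrightarrow> card T = card S \<Longrightarrow> N T \<subseteq> V \<and> p * card V \<le> card (N T)"
  shows "measure_pmf.prob (Pi_pmf I d (\<lambda>_. pmf_of_set V))
      {f. inj_on f S \<and> card {j \<in> I - S. f j \<in> N (f ` S)} \<le> (p - \<epsilon>) * card (I - S)}
    \<le> exp (- 2 * \<epsilon>\<^sup>2 * card (I - S))"
proof (rule prob_Pi_pmf_le[OF I])
  let ?X = "{f. inj_on f S \<and> card {j \<in> I - S. f j \<in> N (f ` S)} \<le> (p - \<epsilon>) * card (I - S)}"
  fix g assume g: "g \<in> set_pmf (Pi_pmf S d (\<lambda>_. pmf_of_set V))"
  let ?merge = "\<lambda>h i. if i \<in> S then g i else h i"
  have "finite S" using I finite_subset by blast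
  hence "g ` S \<subseteq> V" using g V by (auto simp: set_Pi_pmf PiE_dflt_def)
  have "?merge h ` S = g ` S" "inj_on (?merge h) S \<longleftrightarrow> inj_on g S"
    "{j \<in> I - S. ?merge h j \<in> N'} = {j \<in> I - S. h j \<in> N'}" for h N'
    by (auto simp: inj_on_def)
  hence merge: "{h. ?merge h \<in> ?X} =
      {h. inj_on g S \<and> card {j \<in> I - S. h j \<in> N (g ` S)} \<le> (p - \<epsilon>) * card (I - S)}"
    by simp
  show "measure_pmf.prob (Pi_pmf (I - S) d (\<lambda>_. pmf_of_set V)) {h. ?merge h \<in> ?X}
      \<le> exp (- 2 * \<epsilon>\<^sup>2 * card (I - S))"
  proof (cases "inj_on g S")
    case True
    hence "N (g ` S) \<subseteq> V" "p * card V \<le> card (N (g ` S))"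
      using N[OF \<open>g ` S \<subseteq> V\<close>] by (simp_all add: card_image)
    thus ?thesis
      unfolding merge using prob_few_hits_le[of "I - S" V "N (g ` S)" p \<epsilon> d] True I V \<open>0 \<le> \<epsilon>\<close>
      by simp
  next
    case False
    thus ?thesis unfolding merge by simp
  qed
qed simp

lemma prob_collision_le:
  assumes I: "finite I" "i \<in> I" "j \<in> I" "i \<noteq> j" and V: "finite V" "V \<noteq> {}"
  shows "measure_pmf.prob (Pi_pmf I d (\<lambda>_. pmf_of_set V)) {f. f i = f j} \<le> 1 / card V"
proof (rule prob_Pi_pmf_le[of I "I - {i}"])
  fix g :: "'a \<Rightarrow> 'b"
  have rest: "I - (I - {i}) = {i}" using I by blast
  have "measure_pmf.prob (Pi_pmf {i} d (\<lambda>_. pmf_of_set V)) {h. h i = g j} =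
      measure_pmf.prob (map_pmf (\<lambda>h. h i) (Pi_pmf {i} d (\<lambda>_. pmf_of_set V))) {g j}"
    by (simp add: vimage_def)
  also have "\<dots> \<le> 1 / card V"
    using V by (simp add: Pi_pmf_component measure_pmf_single indicator_def)
  finally show "measure_pmf.prob (Pi_pmf (I - (I - {i})) d (\<lambda>_. pmf_of_set V))
      {h. (\<lambda>l. if l \<in> I - {i} then g l else h l) \<in> {f. f i = f j}} \<le> 1 / card V"
    using I by (simp add: rest)
qed (use I in auto)

lemma prob_not_inj_le:
  assumes I: "finite I" and V: "finite V" "V \<noteq> {}"
  shows "measure_pmf.prob (Pi_pmf I d (\<lambda>_. pmf_of_set V)) {f. \<not> inj_on f I} \<le> (card I)\<^sup>2 / card V"
proof -
  let ?P = "measure_pmf.prob (Pi_pmf I d (\<lambda>_. pmf_of_set V))"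
  let ?D = "{(i, j) \<in> I \<times> I. i \<noteq> j}"
  have fin: "finite ?D" using I by (auto intro: finite_subset[of _ "I \<times> I"])
  have "?P {f. \<not> inj_on f I} \<le> ?P (\<Union>(i, j)\<in>?D. {f. f i = f j})"
    by (rule measure_pmf.finite_measure_mono) (auto simp: inj_on_def)
  also have "\<dots> \<le> (\<Sum>(i, j)\<in>?D. ?P {f. f i = f j})"
    using measure_pmf.finite_measure_subadditive_finite[OF fin, of "\<lambda>(i, j). {f. f i = f j}"]
    by (simp add: case_prod_beta')
  also have "\<dots> \<le> (\<Sum>(i, j)\<in>?D. 1 / card V)"
    by (rule sum_mono) (auto intro!: prob_collision_le I V)
  also have "\<dots> \<le> (card I)\<^sup>2 / card V"
  proof -
    have "card ?D \<le> card (I \<times> I)" using I by (intro card_mono) auto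
    hence "real (card ?D) \<le> (card I)\<^sup>2"
      by (simp add: card_cartesian_product power2_eq_square flip: of_nat_mult)
    thus ?thesis by (simp add: case_prod_beta' divide_right_mono)
  qed
  finally show ?thesis .
qed

lemma prob_some_sparse_sample_le:
  fixes p \<epsilon> :: real
  assumes I: "finite I" "s \<le> card I" and V: "finite V" "V \<noteq> {}" and "0 \<le> \<epsilon>"
    and N: "\<And>T. T \<subseteq> V \<Longrightarrow> card T = s \<Longrightarrow> N T \<subseteq> V \<and> p * card V \<le> card (N T)"
  shows "measure_pmf.prob (Pi_pmf I d (\<lambda>_. pmf_of_set V))
      {f. \<exists>S\<subseteq>I. card S = s \<and> inj_on f S \<and>
        card {j \<in> I - S. f j \<in> N (f ` S)} \<le> (p - \<epsilon>) * card (I - S)}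
    \<le> real (card I) ^ s * exp (- 2 * \<epsilon>\<^sup>2 * real (card I - s))"
proof -
  let ?P = "measure_pmf.prob (Pi_pmf I d (\<lambda>_. pmf_of_set V))"
  let ?Ss = "{S. S \<subseteq> I \<and> card S = s}"
  define sparse where "sparse S = {f. inj_on f S \<and>
    card {j \<in> I - S. f j \<in> N (f ` S)} \<le> (p - \<epsilon>) * card (I - S)}" for S
  have "?P (\<Union>S\<in>?Ss. sparse S) \<le> (\<Sum>S\<in>?Ss. ?P (sparse S))"
    by (rule measure_pmf.finite_measure_subadditive_finite) (use I in auto)
  also have "\<dots> \<le> (\<Sum>S\<in>?Ss. exp (- 2 * \<epsilon>\<^sup>2 * real (card I - s)))"
  proof (rule sum_mono)
    fix S assume S: "S \<in> ?Ss"
    hence "card (I - S) = card I - s"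
      using I(1) finite_subset[of S I] by (auto simp: card_Diff_subset)
    thus "?P (sparse S) \<le> exp (- 2 * \<epsilon>\<^sup>2 * real (card I - s))"
      using prob_sparse_sample_le[of I S V \<epsilon> N p d] S I V \<open>0 \<le> \<epsilon>\<close> N unfolding sparse_def by auto
  qed
  also have "\<dots> = real (card I choose s) * exp (- 2 * \<epsilon>\<^sup>2 * real (card I - s))"
    using n_subsets[OF I(1)] by simp
  also have "\<dots> \<le> real (card I) ^ s * exp (- 2 * \<epsilon>\<^sup>2 * real (card I - s))"
    using binomial_le_pow[OF I(2)] by (intro mult_right_mono) (simp_all flip: of_nat_power)
  also have "(\<Union>S\<in>?Ss. sparse S) = {f. \<exists>S\<subseteq>I. card S = s \<and> inj_on f S \<and>
      card {j \<in> I - S. f j \<in> N (f ` S)} \<le> (p - \<epsilon>) * card (I - S)}"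
    unfolding sparse_def by blast
  finally show ?thesis .
qed

lemma ex_dense_sample:
  fixes p \<epsilon> :: real
  assumes V: "finite V" "2 * m\<^sup>2 < card V" and "s \<le> m" "0 \<le> \<epsilon>"
    and N: "\<And>T. T \<subseteq> V \<Longrightarrow> card T = s \<Longrightarrow> N T \<subseteq> V \<and> p * card V \<le> card (N T)"
    and m: "real m ^ s * exp (- 2 * \<epsilon>\<^sup>2 * real (m - s)) < 1 / 2"
  shows "\<exists>f. inj_on f {..<m} \<and> f ` {..<m} \<subseteq> V \<and> (\<forall>S\<subseteq>{..<m}. card S = s \<longrightarrow>
    (p - \<epsilon>) * real (m - s) < card {j \<in> {..<m} - S. f j \<in> N (f ` S)})"
proof -
  define D where "D = Pi_pmf {..<m} undefined (\<lambda>_. pmf_of_set V)"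
  define collide where "collide = {f :: nat \<Rightarrow> 'a. \<not> inj_on f {..<m}}"
  define sparse where "sparse = {f. \<exists>S\<subseteq>{..<m}. card S = s \<and> inj_on f S \<and>
    card {j \<in> {..<m} - S. f j \<in> N (f ` S)} \<le> (p - \<epsilon>) * card ({..<m} - S)}"
  have "V \<noteq> {}" using V(2) by auto
  have "measure_pmf.prob D (collide \<union> sparse) \<le>
      measure_pmf.prob D collide + measure_pmf.prob D sparse"
    by (rule measure_Un_le) simp_all
  also have "measure_pmf.prob D collide \<le> m\<^sup>2 / card V"
    using prob_not_inj_le[of "{..<m}" V] V(1) \<open>V \<noteq> {}\<close> unfolding D_def collide_def by simp
  also have "m\<^sup>2 / card V < 1 / 2" using V(2) by (simp add: divide_less_eq flip: of_nat_power)
  also have "measure_pmf.prob D sparse \<le> real m ^ s * exp (- 2 * \<epsilon>\<^sup>2 * real (m - s))"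
    using prob_some_sparse_sample_le[of "{..<m}" s V \<epsilon> N p] assms \<open>V \<noteq> {}\<close>
    unfolding D_def sparse_def by simp
  finally have "measure_pmf.prob D (collide \<union> sparse) < 1" using m by simp
  then obtain f where f: "f \<in> set_pmf D" "f \<notin> collide \<union> sparse"
    using ex_set_pmf_notin by blast
  have "f ` {..<m} \<subseteq> V"
    using f(1) V(1) \<open>V \<noteq> {}\<close> unfolding D_def by (auto simp: set_Pi_pmf PiE_dflt_def)
  moreover have inj: "inj_on f {..<m}" using f(2) unfolding collide_def by simp
  moreover have "(p - \<epsilon>) * real (m - s) < card {j \<in> {..<m} - S. f j \<in> N (f ` S)}"
    if S: "S \<subseteq> {..<m}" "card S = s" for S
  proof -
    have "card ({..<m} - S) = m - s"
      using S finite_subset[OF S(1)] by (simp add: card_Diff_subset)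
    moreover have "\<not> card {j \<in> {..<m} - S. f j \<in> N (f ` S)} \<le> (p - \<epsilon>) * card ({..<m} - S)"
      using f(2) S inj_on_subset[OF inj S(1)] unfolding sparse_def by blast
    ultimately show ?thesis by simp
  qed
  ultimately show ?thesis by blast
qed

subsection \<open>Existence of the codegree density\<close>

definition pullback :: "nat \<Rightarrow> ('b \<Rightarrow> 'a) \<Rightarrow> 'b set \<Rightarrow> 'a hypergraph \<Rightarrow> 'b hypergraph" where
  "pullback r f I H = \<lparr>verts = I, edges = {e. e \<subseteq> I \<and> card e = r \<and> f ` e \<in> edges H}\<rparr>"

lemma family_free_pullback:
  assumes f: "inj_on f I" "f ` I \<subseteq> verts H" and free: "family_free \<F> H"
  shows "family_free \<F> (pullback r f I H)"
proof -
  have "contains_copy H F" if copy: "contains_copy (pullback r f I H) F" for F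
  proof -
    obtain \<phi> where \<phi>: "inj_on \<phi> (verts F)" "hypergraph_hom \<phi> F (pullback r f I H)"
      using copy unfolding contains_copy_def by blast
    hence "\<phi> ` verts F \<subseteq> I" unfolding hypergraph_hom_def pullback_def by simp
    hence "inj_on (f \<circ> \<phi>) (verts F)" using \<phi>(1) f(1) by (intro comp_inj_on inj_on_subset[OF f(1)])
    moreover have "hypergraph_hom f (pullback r f I H) H"
      using f(2) unfolding hypergraph_hom_def pullback_def by auto
    hence "hypergraph_hom (f \<circ> \<phi>) F H" by (rule hypergraph_hom_comp[OF \<phi>(2)])
    ultimately show ?thesis unfolding contains_copy_def by blast
  qed
  thus ?thesis using free unfolding family_free_def by blast
qed

lemma nbrs_pullback:
  assumes "finite I" "S \<subseteq> I" "card S = r - 1" "r > 0"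
  shows "nbrs (edges (pullback r f I H)) S = {j \<in> I - S. insert (f j) (f ` S) \<in> edges H}"
  using assms finite_subset[OF assms(2,1)] unfolding nbrs_def pullback_def by auto

lemma min_codegree_pullback_ge:
  fixes t :: real
  assumes "finite I" "r > 0" "r \<le> card I"
    and dense: "\<And>S. S \<subseteq> I \<Longrightarrow> card S = r - 1 \<Longrightarrow> t \<le> card {j \<in> I - S. f j \<in> nbrs (edges H) (f ` S)}"
  shows "t \<le> min_codegree r (pullback r f I H)"
proof -
  let ?G = "pullback r f I H"
  have "nat \<lceil>t\<rceil> \<le> min_codegree r ?G"
  proof (rule min_codegree_ge)
    fix S assume "S \<subseteq> verts ?G" and card_S: "card S = r - 1"
    hence S: "S \<subseteq> I" unfolding pullback_def by simp
    note nbrs = nbrs_pullback[OF \<open>finite I\<close> S card_S \<open>r > 0\<close>, of f H]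
    have "{j \<in> I - S. f j \<in> nbrs (edges H) (f ` S)} \<subseteq> nbrs (edges ?G) S"
      unfolding nbrs by (auto simp: nbrs_def)
    moreover have "finite (nbrs (edges ?G) S)" unfolding nbrs using \<open>finite I\<close> by simp
    ultimately have "card {j \<in> I - S. f j \<in> nbrs (edges H) (f ` S)} \<le> card (nbrs (edges ?G) S)"
      by (intro card_mono)
    thus "nat \<lceil>t\<rceil> \<le> card (nbrs (edges ?G) S)" using dense[OF S card_S] by linarith
  qed (use assms in \<open>auto simp: r_graph_def pullback_def\<close>)
  thus ?thesis by linarith
qed

lemma codegree_ex_sample_ge:
  fixes \<epsilon> :: real
  assumes "r > 0" "0 \<le> \<epsilon>" and nonempty: "\<And>F. F \<in> \<F> \<Longrightarrow> edges F \<noteq> {}"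
    and m: "r \<le> m" "real m ^ (r - 1) * exp (- 2 * \<epsilon>\<^sup>2 * real (m - (r - 1))) < 1 / 2"
    and n: "r \<le> n" "2 * m\<^sup>2 < n"
  shows "(codegree_ratio r \<F> n - \<epsilon>) * real (m - (r - 1)) \<le> codegree_ex r m \<F>"
proof -
  define p where "p = codegree_ratio r \<F> n"
  obtain H :: "nat hypergraph" where H: "r_graph r H" "card (verts H) = n" "family_free \<F> H"
    and H_codegree: "min_codegree r H = codegree_ex r n \<F>"
    using codegree_ex_attained[OF \<open>r > 0\<close> n(1) nonempty] by blast
  have "p * n = codegree_ex r n \<F>" unfolding p_def codegree_ratio_def using n(2) by simp
  hence H_nbrs: "nbrs (edges H) T \<subseteq> verts H \<and> p * card (verts H) \<le> card (nbrs (edges H) T)"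
    if "T \<subseteq> verts H" "card T = r - 1" for T
    using min_codegree_le[OF H(1) \<open>r > 0\<close> that] H H_codegree
    unfolding nbrs_def r_graph_def by auto
  have "\<exists>f. inj_on f {..<m} \<and> f ` {..<m} \<subseteq> verts H \<and> (\<forall>S\<subseteq>{..<m}. card S = r - 1 \<longrightarrow>
      (p - \<epsilon>) * real (m - (r - 1)) < card {j \<in> {..<m} - S. f j \<in> nbrs (edges H) (f ` S)})"
    by (rule ex_dense_sample[OF _ _ _ _ H_nbrs m(2)])
      (use H m(1) n(2) \<open>0 \<le> \<epsilon>\<close> in \<open>auto simp: r_graph_def\<close>)
  then obtain f where f: "inj_on f {..<m}" "f ` {..<m} \<subseteq> verts H"
    and dense: "\<And>S. S \<subseteq> {..<m} \<Longrightarrow> card S = r - 1 \<Longrightarrow>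
      (p - \<epsilon>) * real (m - (r - 1)) < card {j \<in> {..<m} - S. f j \<in> nbrs (edges H) (f ` S)}"
    by blast
  let ?G = "pullback r f {..<m} H"
  have "(p - \<epsilon>) * real (m - (r - 1)) \<le> min_codegree r ?G"
    using dense m(1) \<open>r > 0\<close> by (intro min_codegree_pullback_ge) (auto intro: less_imp_le)
  moreover have "r_graph r ?G" "card (verts ?G) = m" unfolding r_graph_def pullback_def by auto
  hence "min_codegree r ?G \<le> codegree_ex r m \<F>"
    using min_codegree_le_codegree_ex[OF \<open>r > 0\<close> m(1)] family_free_pullback[OF f H(3)] by blast
  ultimately show ?thesis unfolding p_def by linarith
qed

lemma codegree_ratio_almost_decreasing:
  fixes \<epsilon> :: real
  assumes "r > 0" and \<epsilon>: "0 < \<epsilon>" and nonempty: "\<And>F. F \<in> \<F> \<Longrightarrow> edges F \<noteq> {}"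
    and m: "r \<le> m" "real r \<le> \<epsilon> * m"
      "real m ^ (r - 1) * exp (- 2 * \<epsilon>\<^sup>2 * real (m - (r - 1))) < 1 / 2"
    and n: "r \<le> n" "2 * m\<^sup>2 < n"
  shows "codegree_ratio r \<F> n - 2 * \<epsilon> \<le> codegree_ratio r \<F> m"
proof -
  define p where "p = codegree_ratio r \<F> n"
  have "p \<le> 1"
    using codegree_ex_le[OF \<open>r > 0\<close> n(1) nonempty] n(2) unfolding p_def codegree_ratio_def by simp
  have "(p - \<epsilon>) * real (m - (r - 1)) \<le> codegree_ex r m \<F>"
    unfolding p_def using assms by (intro codegree_ex_sample_ge) auto
  moreover have "(p - \<epsilon>) * real (m - (r - 1)) = (p - \<epsilon>) * m - (p - \<epsilon>) * real (r - 1)"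
    using m(1) by (simp add: of_nat_diff algebra_simps)
  moreover have "(p - \<epsilon>) * real (r - 1) \<le> 1 * real (r - 1)"
    using \<open>p \<le> 1\<close> \<epsilon> by (intro mult_right_mono) auto
  moreover have "real (r - 1) \<le> \<epsilon> * m" using m(2) by linarith
  ultimately have "(p - \<epsilon>) * m - \<epsilon> * m \<le> codegree_ex r m \<F>" by linarith
  moreover have "m > 0" using m(1) \<open>r > 0\<close> by simp
  ultimately show ?thesis
    unfolding p_def codegree_ratio_def[of r \<F> m] by (simp add: field_simps)
qed

lemma convergent_if_almost_decreasing:
  fixes a :: "nat \<Rightarrow> real"
  assumes "Bseq a" and dec: "\<And>\<epsilon>. \<epsilon> > 0 \<Longrightarrow> \<exists>M. \<forall>m\<ge>M. \<exists>N. \<forall>n\<ge>N. a n - \<epsilon> \<le> a m"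
  shows "convergent a"
proof -
  obtain l h where h: "strict_mono h" "(a \<circ> h) \<longlonglongrightarrow> l"
    using \<open>Bseq a\<close> bounded_imp_convergent_subsequence unfolding Bseq_eq_bounded by blast
  have "a \<longlonglongrightarrow> l"
  proof (rule LIMSEQ_I)
    fix \<epsilon> :: real assume "0 < \<epsilon>"
    hence "0 < \<epsilon> / 3" by simp
    from dec[OF this] obtain M where M: "\<And>m. m \<ge> M \<Longrightarrow> \<exists>N. \<forall>n\<ge>N. a n - \<epsilon> / 3 \<le> a m" by blast
    have lower: "l - \<epsilon> / 3 \<le> a m" if m: "m \<ge> M" for m
    proof -
      obtain N where N: "\<And>n. n \<ge> N \<Longrightarrow> a n - \<epsilon> / 3 \<le> a m" using M[OF m] by blast
      have "(a \<circ> h) j \<le> a m + \<epsilon> / 3" if "j \<ge> N" for j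
        using N[of "h j"] seq_suble[OF h(1), of j] that by simp
      hence "l \<le> a m + \<epsilon> / 3" using LIMSEQ_le_const2[OF h(2)] by blast
      thus ?thesis by simp
    qed
    obtain J where J: "\<And>j. j \<ge> J \<Longrightarrow> norm ((a \<circ> h) j - l) < \<epsilon> / 3"
      using LIMSEQ_D[OF h(2) \<open>0 < \<epsilon> / 3\<close>] by blast
    define m where "m = h (max J M)"
    have "M \<le> m" unfolding m_def using seq_suble[OF h(1), of "max J M"] by simp
    then obtain N where N: "\<And>n. n \<ge> N \<Longrightarrow> a n - \<epsilon> / 3 \<le> a m" using M by blast
    have "norm (a m - l) < \<epsilon> / 3" using J[of "max J M"] unfolding m_def by simp
    hence "a m < l + \<epsilon> / 3" unfolding real_norm_def by linarith
    hence "norm (a n - l) < \<epsilon>" if "n \<ge> max N M" for n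
      using N[of n] lower[of n] that \<open>0 < \<epsilon>\<close> by simp
    thus "\<exists>N. \<forall>n\<ge>N. norm (a n - l) < \<epsilon>" by blast
  qed
  thus ?thesis by (rule convergentI)
qed

lemma Bseq_codegree_ratio:
  assumes "r > 0" "\<And>F. F \<in> \<F> \<Longrightarrow> edges F \<noteq> {}"
  shows "Bseq (codegree_ratio r \<F>)"
proof (rule BfunI)
  show "\<forall>\<^sub>F n in sequentially. norm (codegree_ratio r \<F> n) \<le> 1"
    unfolding eventually_sequentially
  proof (intro exI allI impI)
    fix n assume "r \<le> n"
    thus "norm (codegree_ratio r \<F> n) \<le> 1"
      using codegree_ex_le[OF assms(1) _ assms(2)] \<open>r > 0\<close> unfolding codegree_ratio_def by simp
  qed
qed

theorem convergent_codegree_ratio: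
  assumes "r > 0" and nonempty: "\<And>F. F \<in> \<F> \<Longrightarrow> edges F \<noteq> {}"
  shows "convergent (codegree_ratio r \<F>)"
proof (rule convergent_if_almost_decreasing[OF Bseq_codegree_ratio[OF assms]])
  fix \<epsilon> :: real assume "0 < \<epsilon>"
  have "\<forall>\<^sub>F m in sequentially. real r \<le> \<epsilon> / 2 * real m"
    using \<open>0 < \<epsilon>\<close> by real_asymp
  moreover have "(\<lambda>m. real m ^ (r - 1) * exp (- 2 * (\<epsilon> / 2)\<^sup>2 * (real m - real (r - 1)))) \<longlonglongrightarrow> 0"
    using \<open>0 < \<epsilon>\<close> by real_asymp
  hence "\<forall>\<^sub>F m in sequentially.
      real m ^ (r - 1) * exp (- 2 * (\<epsilon> / 2)\<^sup>2 * (real m - real (r - 1))) < 1 / 2"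
    by (rule order_tendstoD) simp
  ultimately have "\<forall>\<^sub>F m in sequentially. r \<le> m \<and> real r \<le> \<epsilon> / 2 * m \<and>
      real m ^ (r - 1) * exp (- 2 * (\<epsilon> / 2)\<^sup>2 * real (m - (r - 1))) < 1 / 2"
    using eventually_ge_at_top[of r] by eventually_elim (simp add: of_nat_diff)
  then obtain M where M: "\<And>m. m \<ge> M \<Longrightarrow> r \<le> m \<and> real r \<le> \<epsilon> / 2 * m \<and>
      real m ^ (r - 1) * exp (- 2 * (\<epsilon> / 2)\<^sup>2 * real (m - (r - 1))) < 1 / 2"
    unfolding eventually_sequentially by blast
  show "\<exists>M. \<forall>m\<ge>M. \<exists>N. \<forall>n\<ge>N. codegree_ratio r \<F> n - \<epsilon> \<le> codegree_ratio r \<F> m"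
  proof (intro exI allI impI)
    fix m n assume "M \<le> m" "r + 2 * m\<^sup>2 + 1 \<le> n"
    thus "codegree_ratio r \<F> n - \<epsilon> \<le> codegree_ratio r \<F> m"
      using codegree_ratio_almost_decreasing[OF \<open>r > 0\<close> _ nonempty, of "\<epsilon> / 2" \<F> m n] M \<open>0 < \<epsilon>\<close>
      by simp
  qed
qed

subsection \<open>Availability of Young subgroups\<close>

lemma cyc_permutes: "cyc r permutes {1..r}"
  using cycle_permutes[of "[1..<Suc r]"] unfolding cyc_def
  by (simp add: atLeastLessThanSuc_atLeastAtMost del: upt_Suc)

lemma cyc_funpow_permutes: "(cyc r ^^ k) permutes {1..r}"
  by (rule permutes_funpow[OF cyc_permutes])

lemma cyc_nat_pow: "cyc r [^]\<^bsub>sym_group r\<^esub> k = cyc r ^^ k"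
  by (induction k)
    (simp_all add: sym_group_mult sym_group_one funpow_Suc_right del: funpow.simps(2))

lemma cyc_funpow_Suc:
  assumes "j < r"
  shows "(cyc r ^^ k) (Suc j) = Suc ((j + k) mod r)"
proof -
  have "map (cyc r ^^ k) [1..<Suc r] ! j = rotate k [1..<Suc r] ! j"
    unfolding cyc_def by (subst cyclic_rotation) simp_all
  moreover have "(k + j) mod r < r" using assms by simp
  ultimately show ?thesis using assms by (simp add: nth_rotate add.commute del: upt_Suc)
qed

lemma cyc_funpow_invariant_card_dvd:
  assumes "r > 0" and P: "P \<subseteq> {1..r}" "(cyc r ^^ k) ` P = P"
  shows "r div gcd r k dvd card P"
proof -
  define M where "M = {j \<in> {..<r}. Suc j \<in> P}"
  have "P = Suc ` M"
  proof
    show "P \<subseteq> Suc ` M"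
    proof
      fix x assume "x \<in> P"
      thus "x \<in> Suc ` M" using P(1) unfolding M_def by (cases x) auto
    qed
  qed (auto simp: M_def)
  hence "card P = card M" by (simp add: card_image)
  moreover have "(j + k) mod r \<in> M \<longleftrightarrow> j \<in> M" if "j < r" for j
    using inj_image_mem_iff[OF permutes_inj[OF cyc_funpow_permutes[of k r]], of "Suc j" P] P(2)
      cyc_funpow_Suc[OF that, of k] that \<open>r > 0\<close> unfolding M_def by simp
  hence "r div gcd r k dvd card M"
    by (intro shift_invariant_card_dvd[OF \<open>r > 0\<close>]) (auto simp: M_def)
  ultimately show ?thesis by simp
qed

lemma ex_cyc_funpow_invariant_set:
  assumes "r > 0" "r div gcd r k dvd s" "s \<le> r"
  shows "\<exists>P\<subseteq>{1..r}. card P = s \<and> (cyc r ^^ k) ` P = P"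
proof -
  obtain M where M: "M \<subseteq> {..<r}" "card M = s" "\<And>j. j < r \<Longrightarrow> (j + k) mod r \<in> M \<longleftrightarrow> j \<in> M"
    using ex_shift_invariant_set[OF assms] by blast
  have "(cyc r ^^ k) ` Suc ` M \<subseteq> Suc ` M" using M(1,3) by (auto simp: cyc_funpow_Suc)
  moreover have "finite (Suc ` M)" using M(1) finite_subset by blast
  ultimately have "(cyc r ^^ k) ` Suc ` M = Suc ` M"
    using endo_inj_surj permutes_inj_on[OF cyc_funpow_permutes] by blast
  moreover have "Suc ` M \<subseteq> {1..r}" "card (Suc ` M) = s" using M(1,2) by (auto simp: card_image)
  ultimately show ?thesis by blast
qed

lemma conj_image:
  assumes "h permutes A"
  shows "(h \<circ> p \<circ> inv' h) ` (h ` P) = h ` (p ` P)"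
  using permutes_inverses(2)[OF assms] by (simp add: image_image)

lemma conj_permutes:
  assumes "h permutes A" "p permutes A"
  shows "h \<circ> p \<circ> inv' h permutes A"
  unfolding comp_assoc using assms by (intro permutes_compose permutes_inv)

lemma transpose_conj:
  assumes "bij p"
  shows "p \<circ> transpose a b \<circ> inv' p = transpose (p a) (p b)"
proof -
  have "transpose (p a) (p b) \<circ> p = p \<circ> transpose a b"
    using transpose_comp_eq[OF assms, of "p a" "p b"] assms by (simp add: bij_is_inj)
  hence "p \<circ> transpose a b \<circ> inv' p = transpose (p a) (p b) \<circ> (p \<circ> inv' p)"
    by (simp add: comp_assoc[symmetric])
  thus ?thesis using surj_iff[of p] assms by (simp add: bij_is_surj)
qed

lemma young_subgroup_iff:
  assumes "i \<le> r"
  shows "p \<in> young_subgroup r i \<longleftrightarrow> p permutes {1..r} \<and> p ` {1..i} = {1..i}"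
proof -
  have "{Suc i..r} = {1..r} - {1..i}" using assms by auto
  hence "p ` {Suc i..r} = {Suc i..r}" if "p permutes {1..r}" "p ` {1..i} = {1..i}"
    using image_set_diff[OF permutes_inj[OF that(1)], of "{1..r}" "{1..i}"]
      permutes_image[OF that(1)] that(2) by simp
  thus ?thesis unfolding young_subgroup_def by (auto simp: sym_group_carrier)
qed

lemma subgroup_young:
  assumes "i \<le> r"
  shows "subgroup (young_subgroup r i) (sym_group r)"
proof (rule group.subgroupI[OF sym_group_is_group])
  show "young_subgroup r i \<subseteq> carrier (sym_group r)" unfolding young_subgroup_def by auto
  have "id \<in> young_subgroup r i" unfolding young_subgroup_iff[OF assms] by (simp add: permutes_id)
  thus "young_subgroup r i \<noteq> {}" by blast
next
  fix p assume "p \<in> young_subgroup r i"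
  hence p: "p permutes {1..r}" "p ` {1..i} = {1..i}" unfolding young_subgroup_iff[OF assms] by auto
  hence "inv' p ` {1..i} = {1..i}" using image_inv_f_f[OF permutes_inj[OF p(1)]] by metis
  thus "inv\<^bsub>sym_group r\<^esub> p \<in> young_subgroup r i"
    using p(1) permutes_inv[OF p(1)] unfolding young_subgroup_iff[OF assms]
    by (simp add: sym_group_carrier)
next
  fix p q assume "p \<in> young_subgroup r i" "q \<in> young_subgroup r i"
  thus "p \<otimes>\<^bsub>sym_group r\<^esub> q \<in> young_subgroup r i"
    unfolding young_subgroup_iff[OF assms] sym_group_mult by (metis image_comp permutes_compose)
qed

lemma young_subgroup_contains_conjugate_iff:
  assumes "r > 0" "i \<le> r"
  shows "(\<exists>g. g permutes {1..r} \<and> g \<circ> cyc r ^^ k \<circ> inv' g \<in> young_subgroup r i) \<longleftrightarrow>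
    r div gcd r k dvd i"
proof
  assume "\<exists>g. g permutes {1..r} \<and> g \<circ> cyc r ^^ k \<circ> inv' g \<in> young_subgroup r i"
  then obtain g where g: "g permutes {1..r}" "(g \<circ> cyc r ^^ k \<circ> inv' g) ` {1..i} = {1..i}"
    unfolding young_subgroup_iff[OF \<open>i \<le> r\<close>] by blast
  define P where "P = inv' g ` {1..i}"
  have gP: "g ` P = {1..i}"
    unfolding P_def using permutes_inv_o(1)[OF g(1)] by (simp add: image_comp)
  have "g ` (cyc r ^^ k) ` P = g ` P"
    using conj_image[OF g(1), of "cyc r ^^ k" P] g(2) gP by simp
  hence "(cyc r ^^ k) ` P = P" using permutes_inj[OF g(1)] by (simp add: inj_image_eq_iff)
  moreover have "P \<subseteq> {1..r}"
    unfolding P_def using permutes_image[OF permutes_inv[OF g(1)]] \<open>i \<le> r\<close> by fastforce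
  ultimately have "r div gcd r k dvd card P" by (intro cyc_funpow_invariant_card_dvd[OF \<open>r > 0\<close>])
  also have "card P = i" using card_image[OF permutes_inj_on[OF g(1)], of P] gP by simp
  finally show "r div gcd r k dvd i" .
next
  assume "r div gcd r k dvd i"
  then obtain P where P: "P \<subseteq> {1..r}" "card P = i" "(cyc r ^^ k) ` P = P"
    using ex_cyc_funpow_invariant_set[OF \<open>r > 0\<close> _ \<open>i \<le> r\<close>] by blast
  obtain g where g: "g permutes {1..r}" "g ` P = {1..i}"
    using ex_permutes_image_eq[of "{1..r}" P "{1..i}"] P \<open>i \<le> r\<close> by auto
  have "g \<circ> cyc r ^^ k \<circ> inv' g \<in> young_subgroup r i"
    unfolding young_subgroup_iff[OF \<open>i \<le> r\<close>]
    using conj_image[OF g(1), of "cyc r ^^ k" P] conj_permutes[OF g(1) cyc_funpow_permutes]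
      P g by simp
  thus "\<exists>g. g permutes {1..r} \<and> g \<circ> cyc r ^^ k \<circ> inv' g \<in> young_subgroup r i" using g(1) by blast
qed

lemma conjugate_avoiding_iff:
  "conjugate_avoiding r x H \<longleftrightarrow>
    subgroup H (sym_group r) \<and> (\<forall>g. g permutes {1..r} \<longrightarrow> g \<circ> x \<circ> inv' g \<notin> H)"
  unfolding conjugate_avoiding_def
  by (auto simp: sym_group_carrier sym_group_mult sym_group_inv_equality)

lemma not_available_if_dvd:
  assumes "r > 0" "i \<le> r" "r div gcd r k dvd i"
  shows "\<not> available r k i"
proof
  obtain h where h: "h permutes {1..r}" "h \<circ> cyc r ^^ k \<circ> inv' h \<in> young_subgroup r i"
    using young_subgroup_contains_conjugate_iff[OF assms(1,2)] assms(3) by blast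
  assume "available r k i"
  then obtain g where g: "g permutes {1..r}" and avoiding: "conjugate_avoiding r (cyc r ^^ k)
      (g <#\<^bsub>sym_group r\<^esub> young_subgroup r i #>\<^bsub>sym_group r\<^esub> inv\<^bsub>sym_group r\<^esub> g)"
    unfolding available_def maximal_conjugate_avoiding_def cyc_nat_pow
    by (auto simp: sym_group_carrier)
  have "g \<circ> (h \<circ> cyc r ^^ k \<circ> inv' h) \<circ> inv' g \<in>
      g <#\<^bsub>sym_group r\<^esub> young_subgroup r i #>\<^bsub>sym_group r\<^esub> inv\<^bsub>sym_group r\<^esub> g"
    using h(2) g unfolding l_coset_def r_coset_def by (auto simp: sym_group_mult sym_group_carrier)
  moreover have "g \<circ> (h \<circ> cyc r ^^ k \<circ> inv' h) \<circ> inv' g = (g \<circ> h) \<circ> cyc r ^^ k \<circ> inv' (g \<circ> h)"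
    using o_inv_distrib[OF permutes_bij[OF g] permutes_bij[OF h(1)]] by (simp add: comp_assoc)
  ultimately show False
    using avoiding permutes_compose[OF h(1) g] unfolding conjugate_avoiding_iff by metis
qed

context perm_monoid
begin

lemma ex_crossing_transpose_mem:
  assumes X: "finite X" "A \<subseteq> X" and inverse: "\<And>p. p \<in> K \<Longrightarrow> inv' p \<in> K"
    and same_side: "\<And>x y. x \<in> X \<Longrightarrow> y \<in> X \<Longrightarrow> (x \<in> A \<longleftrightarrow> y \<in> A) \<Longrightarrow> transpose x y \<in> K"
    and p: "p \<in> K" "p permutes X" "p ` A \<noteq> A" "p ` A \<noteq> X - A"
  shows "\<exists>u\<in>A. \<exists>w\<in>X - A. transpose u w \<in> K"
proof -
  have moved: "transpose (p x) (p y) \<in> K" if "transpose x y \<in> K" for x y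
    using transpose_conj[OF permutes_bij[OF p(2)], of x y] comp_mem inverse p(1) that by metis
  have mapsto: "p x \<in> X" if "x \<in> X" for x using that permutes_in_image[OF p(2)] by blast
  have "\<not> p ` A \<subseteq> A"
    using endo_inj_surj[OF finite_subset[OF X(2,1)] _ permutes_inj_on[OF p(2)]] p(3) by blast
  then obtain a where a: "a \<in> A" "p a \<notin> A" by blast
  show ?thesis
  proof (cases "\<exists>x\<in>A. p x \<in> A")
    case True
    then obtain x where x: "x \<in> A" "p x \<in> A" by blast
    hence "transpose (p x) (p a) \<in> K" using moved same_side a(1) X(2) by blast
    thus ?thesis using x a mapsto X(2) by blast
  next
    case False
    hence "p ` A \<subseteq> X - A" using mapsto X(2) by blast
    then obtain y where "y \<in> X - A" "y \<notin> p ` A" using p(4) by blast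
    moreover from this obtain x where "x \<in> X" "p x = y"
      using permutes_image[OF p(2)] by (metis DiffD1 imageE)
    ultimately have x: "x \<in> X - A" "p x \<in> X - A" by auto
    have "a \<in> p ` X" using permutes_image[OF p(2)] a(1) X(2) by auto
    then obtain b where b: "b \<in> X" "p b = a" by blast
    hence "b \<notin> A" using False a(1) by blast
    hence "transpose (p b) (p x) \<in> K" using moved same_side x b by blast
    thus ?thesis using x(2) b(2) a(1) by blast
  qed
qed

lemma permutes_mem_if_not_block_system:
  assumes X: "finite X" "A \<subseteq> X" and inverse: "\<And>p. p \<in> K \<Longrightarrow> inv' p \<in> K"
    and stabilizer: "\<And>p. p permutes X \<Longrightarrow> p ` A = A \<Longrightarrow> p \<in> K"
    and p: "p \<in> K" "p permutes X" "p ` A \<noteq> A" "p ` A \<noteq> X - A"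
    and q: "q permutes X"
  shows "q \<in> K"
proof -
  have same_side: "transpose x y \<in> K" if "x \<in> X" "y \<in> X" "x \<in> A \<longleftrightarrow> y \<in> A" for x y
    using that by (intro stabilizer permutes_swap_id) simp_all
  obtain u w where uw: "u \<in> A" "w \<in> X - A" "transpose u w \<in> K"
    using ex_crossing_transpose_mem[OF X inverse same_side p] by blast
  have "transpose x u \<in> K" if "x \<in> X" for x
  proof (cases "x \<in> A")
    case True
    thus ?thesis using same_side[of x u] that uw(1) X(2) by blast
  next
    case False
    hence "transpose x w \<in> K" using same_side[of x w] that uw(2) by blast
    moreover have "transpose w u \<in> K" using uw(3) by (simp add: transpose_commute)
    ultimately show ?thesis by (rule transpose_mem_trans)
  qed
  hence "transpose x y \<in> K" if "x \<in> X" "y \<in> X" for x y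
    using that transpose_mem_trans[of x u y] by (metis transpose_commute)
  thus ?thesis using permutes_mem[OF X(1) q] by blast
qed

end

lemma even_shift_mod_div_gcd_iff:
  fixes j k r :: nat
  assumes "r > 0" and even: "even (r div gcd r k)"
  shows "even ((j + k) mod r div gcd r k) \<longleftrightarrow> odd (j div gcd r k)"
proof -
  define d where "d = gcd r k"
  have d: "d > 0" "r = d * (r div d)" "k = d * (k div d)" unfolding d_def using \<open>r > 0\<close> by auto
  have "coprime (r div d) (k div d)" unfolding d_def using \<open>r > 0\<close> by (intro div_gcd_coprime) auto
  hence "odd (k div d)" using even unfolding d_def by (auto dest: coprime_common_divisor[of _ _ 2])
  moreover have "(j + k) mod r div d = (j + k) div d mod (r div d)"
    using d(1,2) mod_mult2_eq[of "j + k" d "r div d"] by simp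
  moreover have "(j + k) div d = j div d + k div d"
    using d(1,3) div_mult_self2[of d j "k div d"] by simp
  ultimately show ?thesis using even by (simp add: dvd_mod_iff d_def)
qed

lemma ex_set_complemented_by_cyc_funpow:
  assumes "r > 0" and even: "even (r div gcd r k)"
  shows "\<exists>P\<subseteq>{1..r}. (cyc r ^^ k) ` P = {1..r} - P"
proof -
  define P where "P = Suc ` {j \<in> {..<r}. even (j div gcd r k)}"
  have P: "P \<subseteq> {1..r}" unfolding P_def by auto
  have alternate: "(cyc r ^^ k) x \<in> P \<longleftrightarrow> x \<notin> P" if "x \<in> {1..r}" for x
  proof -
    have "x = Suc (x - 1)" "x - 1 < r" using that by auto
    then obtain j where "x = Suc j" "j < r" by blast
    thus ?thesis
      using even_shift_mod_div_gcd_iff[OF assms, of j] \<open>r > 0\<close> by (auto simp: P_def cyc_funpow_Suc)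
  qed
  have "(cyc r ^^ k) ` P = {1..r} - P"
  proof (intro equalityI subsetI)
    fix y assume "y \<in> (cyc r ^^ k) ` P"
    then obtain x where "x \<in> P" "y = (cyc r ^^ k) x" by blast
    thus "y \<in> {1..r} - P"
      using alternate[of x] P permutes_in_image[OF cyc_funpow_permutes[of k r], of x] by auto
  next
    fix y assume y: "y \<in> {1..r} - P"
    hence "y \<in> (cyc r ^^ k) ` {1..r}" using permutes_image[OF cyc_funpow_permutes[of k r]] by simp
    then obtain x where "x \<in> {1..r}" "y = (cyc r ^^ k) x" by blast
    thus "y \<in> (cyc r ^^ k) ` P" using alternate[of x] y by blast
  qed
  thus ?thesis using P by blast
qed

lemma ex_conjugate_swapping_halves:
  assumes "r > 0" and even: "even (r div gcd r k)" and r: "r = 2 * i"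
  shows "\<exists>g. g permutes {1..r} \<and> (g \<circ> cyc r ^^ k \<circ> inv' g) ` {1..i} = {1..r} - {1..i}"
proof -
  obtain P where P: "P \<subseteq> {1..r}" and swap: "(cyc r ^^ k) ` P = {1..r} - P"
    using ex_set_complemented_by_cyc_funpow[OF assms(1,2)] by blast
  have "card P = card ((cyc r ^^ k) ` P)"
    by (rule card_image[OF permutes_inj_on[OF cyc_funpow_permutes], symmetric])
  also have "\<dots> = r - card P"
    unfolding swap using P finite_subset[OF P finite_atLeastAtMost] by (simp add: card_Diff_subset)
  finally have "card P = i" using card_mono[OF finite_atLeastAtMost P] r by simp
  then obtain g where g: "g permutes {1..r}" "g ` P = {1..i}"
    using ex_permutes_image_eq[of "{1..r}" P "{1..i}"] P r by auto
  have "g ` ({1..r} - P) = {1..r} - {1..i}"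
    using image_set_diff[OF permutes_inj[OF g(1)], of "{1..r}" P] permutes_image[OF g(1)] g(2)
    by simp
  thus ?thesis using conj_image[OF g(1), of "cyc r ^^ k" P] swap g by auto
qed

lemma subgroup_sym_group_permutes:
  assumes "subgroup K (sym_group r)" "p \<in> K"
  shows "p permutes {1..r}"
  using subgroup.mem_carrier[OF assms] by (simp add: sym_group_carrier)

lemma subgroup_sym_group_inv:
  assumes "subgroup K (sym_group r)" "p \<in> K"
  shows "inv' p \<in> K"
  using subgroup.m_inv_closed[OF assms] subgroup.mem_carrier[OF assms] by simp

lemma perm_monoid_subgroup:
  assumes "subgroup K (sym_group r)"
  shows "perm_monoid K"
  using subgroup.one_closed[OF assms] subgroup.m_closed[OF assms]
  by unfold_locales (simp_all add: sym_group_one sym_group_mult)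

lemma conjugate_in_overgroup_of_young:
  assumes "r > 0" "i \<le> r" and even: "even (r div gcd r k)"
    and K: "subgroup K (sym_group r)" "young_subgroup r i \<subset> K"
  shows "\<exists>g. g permutes {1..r} \<and> g \<circ> cyc r ^^ k \<circ> inv' g \<in> K"
proof -
  interpret perm_monoid K by (rule perm_monoid_subgroup[OF K(1)])
  note permutes = subgroup_sym_group_permutes[OF K(1)]
    and inverse = subgroup_sym_group_inv[OF K(1)]
  have stabilizer: "p \<in> K" if "p permutes {1..r}" "p ` {1..i} = {1..i}" for p
    using K(2) that young_subgroup_iff[OF \<open>i \<le> r\<close>] by blast
  obtain p where p: "p \<in> K" "p ` {1..i} \<noteq> {1..i}"
    using K(2) permutes young_subgroup_iff[OF \<open>i \<le> r\<close>] by blast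
  show ?thesis
  proof (cases "p ` {1..i} = {1..r} - {1..i}")
    case False
    hence "cyc r ^^ k \<in> K"
      using permutes_mem_if_not_block_system[of "{1..r}" "{1..i}" p] stabilizer inverse p permutes
        cyc_funpow_permutes \<open>i \<le> r\<close> by auto
    thus ?thesis by (intro exI[of _ id]) (simp add: permutes_id)
  next
    case True
    hence "card ({1..r} - {1..i}) = card {1..i}"
      using card_image[OF permutes_inj_on[OF permutes[OF p(1)]]] by metis
    hence "r = 2 * i" using \<open>i \<le> r\<close> by (simp add: card_Diff_subset)
    then obtain g where g: "g permutes {1..r}"
      and swap: "(g \<circ> cyc r ^^ k \<circ> inv' g) ` {1..i} = {1..r} - {1..i}"
      using ex_conjugate_swapping_halves[OF \<open>r > 0\<close> even] by blast
    define q where "q = g \<circ> cyc r ^^ k \<circ> inv' g"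
    have "q permutes {1..r}" unfolding q_def by (rule conj_permutes[OF g cyc_funpow_permutes])
    hence "inv' p \<circ> q permutes {1..r}"
      using permutes_inv[OF permutes[OF p(1)]] by (rule permutes_compose)
    moreover have "(inv' p \<circ> q) ` {1..i} = {1..i}"
      unfolding image_comp[symmetric] swap[folded q_def] True[symmetric]
      using image_inv_f_f[OF permutes_inj[OF permutes[OF p(1)]]] .
    ultimately have "p \<circ> (inv' p \<circ> q) \<in> K" using stabilizer comp_mem p(1) by blast
    moreover have "p \<circ> (inv' p \<circ> q) = q"
      using permutes_inv_o(1)[OF permutes[OF p(1)]] by (simp add: comp_assoc[symmetric])
    ultimately show ?thesis using g unfolding q_def by auto
  qed
qed

lemma available_if_odd:
  assumes "r > 0" "i \<le> r" "odd i" and even: "even (r div gcd r k)"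
  shows "available r k i"
proof -
  have "\<not> r div gcd r k dvd i" using even \<open>odd i\<close> dvd_trans by blast
  hence "conjugate_avoiding r (cyc r ^^ k) (young_subgroup r i)"
    unfolding conjugate_avoiding_iff
    using subgroup_young[OF \<open>i \<le> r\<close>] young_subgroup_contains_conjugate_iff[OF assms(1,2), of k]
    by blast
  moreover have "K = young_subgroup r i"
    if "conjugate_avoiding r (cyc r ^^ k) K" "young_subgroup r i \<subseteq> K" for K
    using conjugate_in_overgroup_of_young[OF assms(1,2) even, of K] that
    unfolding conjugate_avoiding_iff by blast
  ultimately have "maximal_conjugate_avoiding r (cyc r ^^ k) (young_subgroup r i)"
    unfolding maximal_conjugate_avoiding_def by blast
  moreover have "id <#\<^bsub>sym_group r\<^esub> young_subgroup r i #>\<^bsub>sym_group r\<^esub> inv\<^bsub>sym_group r\<^esub> id =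
      young_subgroup r i"
    unfolding l_coset_def r_coset_def by (simp add: sym_group_mult sym_group_carrier permutes_id)
  ultimately show ?thesis
    unfolding available_def cyc_nat_pow
    by (intro bexI[of _ id]) (simp_all add: sym_group_carrier permutes_id)
qed

lemma all_odd_available_iff:
  assumes "r > 0"
  shows "even r \<and> (\<forall>i\<in>{1..r - 1}. odd i \<longrightarrow> available r k i) \<longleftrightarrow> even (r div gcd r k)"
proof
  assume available: "even r \<and> (\<forall>i\<in>{1..r - 1}. odd i \<longrightarrow> available r k i)"
  show "even (r div gcd r k)"
  proof (rule ccontr)
    assume odd: "odd (r div gcd r k)"
    hence "r div gcd r k \<noteq> r" "r div gcd r k \<noteq> 0" using available by (auto simp: odd_pos)
    moreover have "r div gcd r k \<le> r" by simp
    ultimately have "r div gcd r k \<in> {1..r - 1}" unfolding atLeastAtMost_iff by linarith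
    thus False using available odd not_available_if_dvd[OF assms] by fastforce
  qed
next
  assume even: "even (r div gcd r k)"
  have "r div gcd r k dvd r" using dvd_triv_left[of "r div gcd r k" "gcd r k"] by simp
  hence "even r" using even dvd_trans by blast
  thus "even r \<and> (\<forall>i\<in>{1..r - 1}. odd i \<longrightarrow> available r k i)"
    using available_if_odd[OF assms _ _ even] by auto
qed

subsection \<open>The codegree density of tight cycles\<close>

lemma codegree_density_eq_half:
  assumes "r > 0" and even: "even (r div gcd r k)"
  shows "codegree_density r (cycle_hom_family r k) = 1 / 2"
proof -
  let ?a = "codegree_ratio r (cycle_hom_family r k)"
  have "?a \<longlonglongrightarrow> 1 / 2"
  proof (rule tendsto_sandwich)
    show "\<forall>\<^sub>F n in sequentially. 1 / 2 - (real r + 1) / real n \<le> ?a n"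
      unfolding eventually_sequentially
    proof (intro exI allI impI)
      fix n assume n: "r \<le> n"
      have "real n / 2 - (real r + 1) \<le> codegree_ex r n (cycle_hom_family r k)"
        using codegree_ex_ge_half[OF \<open>r > 0\<close> n even] by linarith
      hence "(real n / 2 - (real r + 1)) / n \<le> ?a n"
        unfolding codegree_ratio_def by (rule divide_right_mono) simp
      thus "1 / 2 - (real r + 1) / real n \<le> ?a n"
        using n \<open>r > 0\<close> by (simp add: diff_divide_distrib)
    qed
    show "\<forall>\<^sub>F n in sequentially. ?a n \<le> 1 / 2"
      unfolding eventually_sequentially
    proof (intro exI allI impI)
      fix n assume n: "r \<le> n"
      have "2 * codegree_ex r n (cycle_hom_family r k) \<le> n"
        using not_free_if_min_codegree_gt_half[OF _ \<open>r > 0\<close>] n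
        by (intro mult_codegree_ex_le[OF \<open>r > 0\<close> n edges_nonempty_cycle_hom_family]) auto
      thus "?a n \<le> 1 / 2"
        using n \<open>r > 0\<close> unfolding codegree_ratio_def by (simp add: divide_le_eq)
    qed
    show "(\<lambda>n. 1 / 2 - (real r + 1) / real n) \<longlonglongrightarrow> 1 / 2" by real_asymp
  qed simp
  thus ?thesis unfolding codegree_density_def by (rule limI)
qed

lemma codegree_density_le_third:
  assumes "3 \<le> r" and odd: "odd (r div gcd r k)"
  shows "codegree_density r (cycle_hom_family r k) \<le> 1 / 3"
proof -
  let ?a = "codegree_ratio r (cycle_hom_family r k)"
  have "r > 0" using assms by simp
  have "?a \<longlonglongrightarrow> codegree_density r (cycle_hom_family r k)"
    using convergent_codegree_ratio[OF \<open>r > 0\<close> edges_nonempty_cycle_hom_family]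
    unfolding codegree_density_def convergent_LIMSEQ_iff .
  moreover have "?a n \<le> 1 / 3" if n: "r \<le> n" for n
  proof -
    have "3 * codegree_ex r n (cycle_hom_family r k) \<le> n"
      using not_free_if_min_codegree_gt_third[OF _ \<open>3 \<le> r\<close> _ odd] n
      by (intro mult_codegree_ex_le[OF \<open>r > 0\<close> n edges_nonempty_cycle_hom_family]) auto
    thus ?thesis using n \<open>r > 0\<close> unfolding codegree_ratio_def by (simp add: divide_le_eq)
  qed
  ultimately show ?thesis using LIMSEQ_le_const2 by blast
qed

lemma three_le_if_odd_order:
  fixes r k :: nat
  assumes "2 \<le> r" "\<not> [k = 0] (mod r)" "odd (r div gcd r k)"
  shows "3 \<le> r"
proof (rule ccontr)
  assume "\<not> 3 \<le> r"
  hence "r = 2" using assms(1) by simp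
  moreover from this have "odd k" using assms(2) by (auto simp: Cong.cong_def)
  hence "gcd 2 k = 1" by (simp add: coprime_iff_gcd_eq_1[symmetric])
  ultimately show False using assms(3) by simp
qed

theorem theorem11:
  fixes r k :: nat
  assumes "r \<ge> 2" and "\<not> [k = 0] (mod r)"
  shows "convergent (codegree_ratio r (hom_family r (tight_cycle_family r k))) \<and>
    (if even r \<and> (\<forall>i\<in>{1..r - 1}. odd i \<longrightarrow> available r k i)
     then codegree_density r (hom_family r (tight_cycle_family r k)) = 1 / 2
     else codegree_density r (hom_family r (tight_cycle_family r k)) \<le> 1 / 3)"
proof -
  have "r > 0" using assms(1) by simp
  have "convergent (codegree_ratio r (cycle_hom_family r k))"
    by (rule convergent_codegree_ratio[OF \<open>r > 0\<close> edges_nonempty_cycle_hom_family])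
  moreover have "codegree_density r (cycle_hom_family r k) = 1 / 2" if "even (r div gcd r k)"
    using \<open>r > 0\<close> that by (rule codegree_density_eq_half)
  moreover have "codegree_density r (cycle_hom_family r k) \<le> 1 / 3" if "odd (r div gcd r k)"
    using codegree_density_le_third[OF three_le_if_odd_order[OF assms that] that] .
  ultimately show ?thesis using all_odd_available_iff[OF \<open>r > 0\<close>, of k] by presburger
qed

end
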